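(* Let $H$ be a finite connected $(d,r)$-regular hypergraph with $d\ge r$. Let $n_1=|V(H)|$, $n_2=|E(H)|$, $q=(d-1)(r-1)$, assume $q\ne 0$, and let $\chi=\chi(B_H)$. Let $p(u)$ be a polynomial in $u$. Then $\zeta_H(u)$ has the following functional equations (as identities of rational functions in $u$). 1. If $p(u)^{n_1}=\pm(qu^2)^{n_1}\,p\!\left(\frac{1}{qu}\right)^{n_1}$, then $$\Lambda_H(u):=p(u)^{n_1}(1-u)^{-\chi}(1+(r-1)u)^{n_2-n_1}\zeta_H(u)=\pm\Lambda_H\!\left(\tfrac{1}{qu}\right),$$ with the same sign. 2. If $p(u)^{n_2}=\pm(qu^2)^{n_2}\,p\!\left(\frac{1}{qu}\right)^{n_2}$, then $$\tilde\Lambda_H(u):=p(u)^{n_2}(1-u)^{-\chi}(1+(d-1)u)^{n_1-n_2}\zeta_H(u)=\pm\tilde\Lambda_H\!\left(\tfrac{1}{qu}\right),$$ with the same sign.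
   Context: A hypergraph $H=(V,E)$ consists of a set $V=V(H)$ of hypervertices and a family $E=E(H)$ of hyperedges, each a nonempty subset of $V$, with union $V$; repeated hyperedges are allowed and count as distinct elements of $E$. $H$ is $(d,r)$-regular if every hypervertex is in exactly $d$ hyperedges and every hyperedge contains exactly $r$ hypervertices. The associated bipartite graph $B_H$ has vertex set $V\sqcup E$, with $v$ adjacent to $e$ iff $v\in e$; $H$ is connected if $B_H$ is; $\chi(B_H)=|V(B_H)|-|E(B_H)|$, the number of vertices minus the number of edges of $B_H$. A closed path of length $k\ge 1$ in $H$ is a sequence $c=(v_1,e_1,\dots,v_k,e_k,v_1)$ with $v_i\in e_{i-1}\cap e_i$ and $v_i\ne v_{i+1}$ for all $i\in\mathbb Z/k\mathbb Z$. It has hyperedge backtracking if it contains consecutive entries $(e,v,e)$. $c^m$ is $c$ traversed $m$ times; $c$ is tail-less if $c^2$ has no hyperedge backtracking. A primitive cycle is a closed path without hyperedge backtracking, tail-less, and not of the form $b^m$ with $m\ge2$, $b$ a closed path. Prime cycles $\mathfrak p$ are equivalence classes of primitive cycles under cyclic permutation, of length $|\mathfrak p|$. For $|u|$ sufficiently small, $\zeta_H(u)=\prod_{\mathfrak p}(1-u^{|\mathfrak p|})^{-1}$, the product over all prime cycles; $\zeta_H$ continues to a rational function (the inverse of a polynomial), also denoted $\zeta_H$. *)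

theory Defs
  imports "HOL-Analysis.Analysis" "HOL-Computational_Algebra.Polynomial"
begin

text \<open>
  A family of hyperedges is an index set \<open>hyperedges H\<close> with a map \<open>members H\<close> giving the subset
  of hypervertices of each index, so that repeated hyperedges are distinct.
\<close>

record ('v, 'e) hypergraph =
  hypervertices :: "'v set"
  hyperedges :: "'e set"
  members :: "'e \<Rightarrow> 'v set"

definition is_hypergraph :: "('v, 'e) hypergraph \<Rightarrow> bool" where
  "is_hypergraph H \<longleftrightarrow>
     (\<forall>e\<in>hyperedges H. members H e \<noteq> {} \<and> members H e \<subseteq> hypervertices H) \<and>
     (\<Union>e\<in>hyperedges H. members H e) = hypervertices H"

definition finite_hypergraph :: "('v, 'e) hypergraph \<Rightarrow> bool" where
  "finite_hypergraph H \<longleftrightarrow> finite (hypervertices H) \<and> finite (hyperedges H)"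

definition regular_hypergraph :: "nat \<Rightarrow> nat \<Rightarrow> ('v, 'e) hypergraph \<Rightarrow> bool" where
  "regular_hypergraph d r H \<longleftrightarrow>
     (\<forall>v\<in>hypervertices H. card {e \<in> hyperedges H. v \<in> members H e} = d) \<and>
     (\<forall>e\<in>hyperedges H. card (members H e) = r)"


definition bip_vertices :: "('v, 'e) hypergraph \<Rightarrow> ('v + 'e) set" where
  "bip_vertices H = hypervertices H <+> hyperedges H"

definition bip_edges :: "('v, 'e) hypergraph \<Rightarrow> ('v + 'e) set set" where
  "bip_edges H =
     {{Inl v, Inr e} | v e. v \<in> hypervertices H \<and> e \<in> hyperedges H \<and> v \<in> members H e}"

definition connected_hypergraph :: "('v, 'e) hypergraph \<Rightarrow> bool" where
  "connected_hypergraph H \<longleftrightarrow>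
     (\<forall>x\<in>bip_vertices H. \<forall>y\<in>bip_vertices H. (x, y) \<in> {(a, b). {a, b} \<in> bip_edges H}\<^sup>*)"

definition euler_char :: "('v, 'e) hypergraph \<Rightarrow> int" where
  "euler_char H = int (card (bip_vertices H)) - int (card (bip_edges H))"


text \<open>
  The closed path \<open>(v\<^sub>1, e\<^sub>1, \<dots>, v\<^sub>k, e\<^sub>k, v\<^sub>1)\<close> is represented by the list
  \<open>[(v\<^sub>1, e\<^sub>1), \<dots>, (v\<^sub>k, e\<^sub>k)]\<close>, without the redundant last entry. Its length \<open>k\<close> is the length
  of the list, \<open>c\<^sup>m\<close> is the \<open>m\<close>-fold concatenation, and a cyclic permutation is a rotation.
\<close>

definition closed_path :: "('v, 'e) hypergraph \<Rightarrow> ('v \<times> 'e) list \<Rightarrow> bool" where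
  "closed_path H c \<longleftrightarrow> c \<noteq> [] \<and>
     (\<forall>i<length c.
        let v = fst (c ! i); e = snd (c ! i); v' = fst (c ! (Suc i mod length c))
        in v \<in> hypervertices H \<and> e \<in> hyperedges H \<and>
           v \<in> members H e \<and> v' \<in> members H e \<and> v \<noteq> v')"

text \<open>
  Only entries consecutive in \<open>(v\<^sub>1, e\<^sub>1, \<dots>, v\<^sub>k, e\<^sub>k, v\<^sub>1)\<close> count, so \<open>e\<^sub>k\<close> and \<open>e\<^sub>1\<close> are not
  compared here; they are compared in \<open>tail_less\<close>.
\<close>

definition hyperedge_backtracking :: "('v \<times> 'e) list \<Rightarrow> bool" where
  "hyperedge_backtracking c \<longleftrightarrow> (\<exists>i. Suc i < length c \<and> snd (c ! i) = snd (c ! Suc i))"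

definition path_power :: "('v \<times> 'e) list \<Rightarrow> nat \<Rightarrow> ('v \<times> 'e) list" where
  "path_power c m = concat (replicate m c)"

definition tail_less :: "('v \<times> 'e) list \<Rightarrow> bool" where
  "tail_less c \<longleftrightarrow> \<not> hyperedge_backtracking (path_power c 2)"

definition primitive_cycle :: "('v, 'e) hypergraph \<Rightarrow> ('v \<times> 'e) list \<Rightarrow> bool" where
  "primitive_cycle H c \<longleftrightarrow>
     closed_path H c \<and> \<not> hyperedge_backtracking c \<and> tail_less c \<and>
     \<not> (\<exists>b m. m \<ge> 2 \<and> closed_path H b \<and> c = path_power b m)"

definition prime_cycles :: "('v, 'e) hypergraph \<Rightarrow> ('v \<times> 'e) list set set" where
  "prime_cycles H = {c. primitive_cycle H c} // {(c, c'). \<exists>n. c' = rotate n c}"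

definition prime_length :: "('v \<times> 'e) list set \<Rightarrow> nat" where
  "prime_length P = the_elem (length ` P)"


text \<open>
  The product over all prime cycles is unordered: the limit of the finite partial products, as
  in \<^const>\<open>has_sum\<close>. The zeta function is the rational function which is the inverse of the
  unique polynomial \<open>Z\<close> such that \<open>1 / Z(u)\<close> is the value of this product near \<open>0\<close>.
\<close>

definition has_euler_product :: "('v, 'e) hypergraph \<Rightarrow> complex \<Rightarrow> complex \<Rightarrow> bool" where
  "has_euler_product H u z \<longleftrightarrow>
     ((\<lambda>F. \<Prod>P\<in>F. inverse (1 - u ^ prime_length P)) \<longlongrightarrow> z)
       (finite_subsets_at_top (prime_cycles H))"

definition zeta_inv_poly :: "('v, 'e) hypergraph \<Rightarrow> complex poly" where
  "zeta_inv_poly H =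
     (THE Z. \<exists>\<epsilon>>0. \<forall>u. norm u < \<epsilon> \<longrightarrow>
        poly Z u \<noteq> 0 \<and> has_euler_product H u (inverse (poly Z u)))"

definition hypergraph_zeta :: "('v, 'e) hypergraph \<Rightarrow> complex \<Rightarrow> complex" where
  "hypergraph_zeta H u = inverse (poly (zeta_inv_poly H) u)"


text \<open>
  Rational functions over the complex numbers are equal iff their values agree at all but
  finitely many points, so the junk values at poles (where division by zero is zero) are
  irrelevant.
\<close>

definition rational_eq :: "(complex \<Rightarrow> complex) \<Rightarrow> (complex \<Rightarrow> complex) \<Rightarrow> bool" where
  "rational_eq f g \<longleftrightarrow> (\<forall>\<^sub>F u in cofinite. f u = g u)"

definition Lambda :: "('v, 'e) hypergraph \<Rightarrow> nat \<Rightarrow> complex poly \<Rightarrow> complex \<Rightarrow> complex" where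
  "Lambda H r p u =
     (let n\<^sub>1 = card (hypervertices H); n\<^sub>2 = card (hyperedges H)
      in poly p u ^ n\<^sub>1 * (1 - u) powi (- euler_char H) *
         (1 + (of_nat r - 1) * u) powi (int n\<^sub>2 - int n\<^sub>1) * hypergraph_zeta H u)"

definition Lambda_tilde :: "('v, 'e) hypergraph \<Rightarrow> nat \<Rightarrow> complex poly \<Rightarrow> complex \<Rightarrow> complex" where
  "Lambda_tilde H d p u =
     (let n\<^sub>1 = card (hypervertices H); n\<^sub>2 = card (hyperedges H)
      in poly p u ^ n\<^sub>2 * (1 - u) powi (- euler_char H) *
         (1 + (of_nat d - 1) * u) powi (int n\<^sub>1 - int n\<^sub>2) * hypergraph_zeta H u)"

end

theory Submission
  imports Defs "Jordan_Normal_Form.Schur_Decomposition"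
begin

text \<open>
  The idea is the classical one for the Ihara zeta function: write the zeta function as the
  reciprocal of a determinant of the size of the set of hypervertices (or of hyperedges), in which the
  functional equation is visible.

  A flag is a pair \<open>(v, e)\<close> of a hypervertex in a hyperedge. Tail-less closed paths without hyperedge
  backtracking are exactly the cyclic walks of the directed graph on flags in which \<open>(v, e)\<close> is joined
  to \<open>(v', e')\<close> if \<open>v' \<in> e\<close>, \<open>v' \<noteq> v\<close> and \<open>e' \<noteq> e\<close> (lemma \<open>cyclic_walks_flags_iff\<close>). Let \<open>T\<close> be its
  adjacency matrix. For any finite directed graph, the Euler product over primes is
  \<open>1 / det (1 - u T)\<close> for small \<open>u\<close> (theorem \<open>euler_product_eq_inverse_det\<close>): every cyclic walk is a
  power of a unique primitive one, so that summing \<open>u\<^bsup>length c\<^esup> / length c\<close> over all cyclic walks \<open>c\<close>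
  gives the logarithm of the Euler product, while grouping by length gives the sum of
  \<open>trace (T\<^sup>k) u\<^sup>k / k\<close>.

  Regularity enters in the evaluation of \<open>det (1 - u T)\<close>. The matrix is
  \<open>T = (C C\<^sup>T - 1) (S S\<^sup>T - 1)\<close>, where \<open>C\<close> and \<open>S\<close> are the incidence matrices of flags with hyperedges
  and with hypervertices, and \<open>C\<^sup>T C = r\<close>, \<open>S\<^sup>T S = d\<close>. Two applications of
  \<open>det (1 + A B) = det (1 + B A)\<close> reduce the size of the determinant from the number \<open>N\<close> of flags to
  \<open>n\<^sub>1\<close> (lemma \<open>det_regular_incidence\<close>):
  \<open>det (1 - u T) = (1 - u)\<^bsup>N - n\<^sub>1 - n\<^sub>2\<^esup> \<alpha>\<^bsup>n\<^sub>2 - n\<^sub>1\<^esup> det (\<alpha> \<beta> - u K)\<close>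
  with \<open>\<alpha> = 1 + (r - 1) u\<close>, \<open>\<beta> = 1 + (d - 1) u\<close> and \<open>K = S\<^sup>T C C\<^sup>T S\<close>. As \<open>N\<close> is the number of edges of
  the bipartite graph, the first exponent is minus its Euler characteristic. So the factors in
  \<open>Lambda\<close> cancel all but the last determinant, and that one is multiplied by \<open>(q u\<^sup>2)\<^bsup>n\<^sub>1\<^esup>\<close> when
  \<open>1 / (q u)\<close> is replaced by \<open>u\<close>, because \<open>\<alpha> \<beta>\<close> is a quadratic polynomial in \<open>u\<close> with leading
  coefficient \<open>q\<close> and constant coefficient \<open>1\<close> (lemma \<open>det_functional_equation\<close>). The second functional
  equation arises in the same way after exchanging hypervertices and hyperedges.
\<close>

section \<open>Powers and rotations of words\<close>

definition primitive_word :: "'a list \<Rightarrow> bool" where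
  "primitive_word c \<longleftrightarrow> c \<noteq> [] \<and> (\<forall>b m. c = concat (replicate m b) \<longrightarrow> m < 2)"

lemma primitive_word_nonempty: "primitive_word c \<Longrightarrow> c \<noteq> []"
  unfolding primitive_word_def by (rule conjunct1)

lemma length_concat_replicate: "length (concat (replicate m b)) = m * length b"
  by (induction m) auto

lemma nth_concat_replicate:
  "i < m * length b \<Longrightarrow> concat (replicate m b) ! i = b ! (i mod length b)"
proof (induction m arbitrary: i)
  case (Suc m)
  show ?case
  proof (cases "i < length b")
    case False
    then have "i - length b < m * length b"
      using Suc.prems by auto
    with Suc.IH[of "i - length b"] False show ?thesis
      by (simp add: nth_append le_mod_geq)
  qed (simp add: nth_append)
qed simp

lemma concat_replicate_mult:
  "concat (replicate m (concat (replicate k b))) = concat (replicate (m * k) b)"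
  by (induction m) (auto simp: replicate_add)

lemma take_concat_replicate: "m > 0 \<Longrightarrow> take (length b) (concat (replicate m b)) = b"
  by (cases m) auto

lemma rotate_concat_replicate:
  "rotate n (concat (replicate m b)) = concat (replicate m (rotate n b))"
proof (rule nth_equalityI)
  fix i
  assume "i < length (rotate n (concat (replicate m b)))"
  then have i: "i < m * length b"
    by (simp add: length_concat_replicate)
  then have pos: "m * length b > 0" "length b > 0"
    by (auto intro: gr0I)
  have "rotate n (concat (replicate m b)) ! i = b ! (((n + i) mod (m * length b)) mod length b)"
    using i pos by (simp add: nth_rotate length_concat_replicate nth_concat_replicate)
  also have "\<dots> = b ! ((n + i mod length b) mod length b)"
    by (simp add: mod_mod_cancel mod_add_right_eq)
  also have "\<dots> = concat (replicate m (rotate n b)) ! i"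
    using i pos by (simp add: nth_rotate nth_concat_replicate)
  finally show "rotate n (concat (replicate m b)) ! i = concat (replicate m (rotate n b)) ! i" .
qed (simp add: length_concat_replicate)

lemma rotate_mult_period: "rotate g c = c \<Longrightarrow> rotate (k * g) c = c"
  by (induction k) (auto simp flip: rotate_rotate)

lemma rotate_inverse: "\<exists>k. rotate k (rotate n c) = c"
proof
  show "rotate (n * (length c - 1)) (rotate n c) = c"
    by (cases "length c") (auto simp: rotate_rotate add.commute simp flip: mult_Suc_right)
qed

text \<open>
  Comparing the entries of \<open>c\<close> and of its rotation at position \<open>i - g\<close> moves \<open>i\<close> down by \<open>g\<close>.
\<close>
lemma nth_mod_period:
  assumes "rotate g c = c" and "i < length c"
  shows "c ! i = c ! (i mod g)"
  using assms(2)
proof (induction i rule: less_induct)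
  case (less i)
  show ?case
  proof (cases "g > 0 \<and> g \<le> i")
    case True
    then have "c ! (i - g) = rotate g c ! (i - g)"
      using assms(1) by simp
    also have "\<dots> = c ! i"
      using True less.prems by (subst nth_rotate) auto
    finally show ?thesis
      using less.IH[of "i - g"] less.prems True by (simp add: le_mod_geq)
  qed (cases "g = 0"; simp)
qed

text \<open>
  The least positive rotation fixing \<open>b\<close> divides every rotation that does so, and the prefix
  of \<open>b\<close> of that length is a root of \<open>b\<close>; primitivity forces this length to be the full one.
\<close>
lemma primitive_word_rotate_eq_iff:
  assumes "primitive_word b"
  shows "rotate n b = b \<longleftrightarrow> length b dvd n"
proof
  assume n: "rotate n b = b"
  define g where "g = (LEAST g. 0 < g \<and> rotate g b = b)"
  have "length b > 0" "rotate (length b) b = b"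
    using assms by (auto simp: primitive_word_def)
  then have g: "0 < g \<and> rotate g b = b"
    unfolding g_def by (intro LeastI[of "\<lambda>g. 0 < g \<and> rotate g b = b" "length b"] conjI)
  have least: "g \<le> k" if "0 < k" "rotate k b = b" for k
    unfolding g_def using that by (intro Least_le conjI)
  have dvd: "g dvd k" if k: "rotate k b = b" for k
  proof (rule ccontr)
    assume "\<not> g dvd k"
    then have pos: "0 < k mod g"
      by (auto simp: dvd_eq_mod_eq_0)
    have "rotate (k mod g) b = rotate (k mod g) (rotate (k div g * g) b)"
      using g by (simp add: rotate_mult_period)
    also have "\<dots> = b"
      using k by (simp add: rotate_rotate)
    finally have "g \<le> k mod g"
      using pos by (intro least)
    moreover have "k mod g < g"
      using g by (intro mod_less_divisor) simp
    ultimately show False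
      by simp
  qed
  obtain k where k: "length b = k * g"
    using dvd[OF \<open>rotate (length b) b = b\<close>] by (metis dvdE mult.commute)
  have "k > 0"
    using k \<open>length b > 0\<close> by (intro gr0I) simp
  then have "g \<le> length b"
    using k by simp
  have "b = concat (replicate k (take g b))"
  proof (rule nth_equalityI)
    show "length b = length (concat (replicate k (take g b)))"
      using k \<open>g \<le> length b\<close> by (simp add: length_concat_replicate min_absorb2)
    fix i assume i: "i < length b"
    then show "b ! i = concat (replicate k (take g b)) ! i"
      using k g nth_mod_period[of g b i] \<open>g \<le> length b\<close>
      by (simp add: nth_concat_replicate min_absorb2)
  qed
  then have "k < 2"
    using assms by (auto simp: primitive_word_def)
  then have "g = length b"
    using \<open>k > 0\<close> k by (cases k) auto
  then show "length b dvd n"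
    using dvd[OF n] by simp
next
  assume "length b dvd n"
  then show "rotate n b = b"
    by (intro rotate_id) (simp add: dvd_eq_mod_eq_0)
qed

lemma primitive_word_rotate:
  assumes "primitive_word b"
  shows "primitive_word (rotate n b)"
  unfolding primitive_word_def
proof (intro conjI allI impI)
  fix d m
  assume "rotate n b = concat (replicate m d)"
  moreover obtain k where "rotate k (rotate n b) = b"
    using rotate_inverse by blast
  ultimately have "b = concat (replicate m (rotate k d))"
    by (simp add: rotate_concat_replicate)
  then show "m < 2"
    using assms by (auto simp: primitive_word_def)
qed (use assms in \<open>auto simp: primitive_word_def\<close>)

lemma primitive_root_exists:
  assumes "c \<noteq> []"
  shows "\<exists>b m. m \<ge> 1 \<and> primitive_word b \<and> c = concat (replicate m b)"
  using assms
proof (induction c rule: length_induct)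
  case (1 c)
  show ?case
  proof (cases "primitive_word c")
    case True
    then show ?thesis
      by (intro exI[of _ c] exI[of _ 1]) simp
  next
    case False
    then obtain b m where m: "m \<ge> 2" "c = concat (replicate m b)"
      using "1.prems" by (auto simp: primitive_word_def not_less)
    then have b: "b \<noteq> []" "length b < length c"
      using "1.prems" by (auto simp: length_concat_replicate)
    then obtain d k where "k \<ge> 1" "primitive_word d" "b = concat (replicate k d)"
      using "1.IH" by blast
    then show ?thesis
      using m by (intro exI[of _ d] exI[of _ "m * k"]) (auto simp: concat_replicate_mult)
  qed
qed

lemma concat_replicate_inject:
  assumes "concat (replicate m b) = concat (replicate k d)" "m \<ge> 1" "k \<ge> 1" "length b = length d"
  shows "b = d"
proof -
  have "b = take (length b) (concat (replicate m b))"
    using assms(2) by (intro take_concat_replicate[symmetric]) simp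
  also have "\<dots> = take (length d) (concat (replicate k d))"
    by (simp only: assms(1,4))
  also have "\<dots> = d"
    using assms(3) by (intro take_concat_replicate) simp
  finally show ?thesis .
qed

text \<open>
  Rotation by \<open>length d\<close> fixes every power of \<open>d\<close>, hence the common power, hence its root \<open>b\<close>.
\<close>
lemma length_primitive_root_dvd:
  assumes b: "primitive_word b" and m: "m \<ge> 1"
    and eq: "concat (replicate m b) = concat (replicate k d)"
  shows "length b dvd length d"
proof -
  have "concat (replicate m (rotate (length d) b)) = rotate (length d) (concat (replicate k d))"
    by (simp only: rotate_concat_replicate flip: eq)
  also have "\<dots> = concat (replicate m b)"
    by (simp only: rotate_concat_replicate rotate_id mod_self eq)
  finally have "rotate (length d) b = b"
    using m by (rule concat_replicate_inject) (use m in simp_all)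
  then show ?thesis
    by (simp only: primitive_word_rotate_eq_iff[OF b])
qed

text \<open>
  By the preceding lemma the lengths of two primitive roots divide each other, and a root is the
  prefix of its length.
\<close>
lemma primitive_root_unique:
  assumes b: "primitive_word b" and d: "primitive_word d" and mk: "m \<ge> 1" "k \<ge> 1"
    and eq: "concat (replicate m b) = concat (replicate k d)"
  shows "b = d \<and> m = k"
proof
  have len: "length b = length d"
    by (intro dvd_antisym length_primitive_root_dvd[OF b mk(1) eq]
        length_primitive_root_dvd[OF d mk(2) eq[symmetric]])
  show "b = d"
    by (rule concat_replicate_inject[OF eq mk len])
  have "m * length b = k * length b"
    using arg_cong[OF eq, of length] by (simp only: length_concat_replicate len)
  then show "m = k"
    using primitive_word_nonempty[OF b] by simp
qed

section \<open>Cyclic walks and their prime classes\<close>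

definition cyclic_walks :: "'a set \<Rightarrow> ('a \<Rightarrow> 'a \<Rightarrow> bool) \<Rightarrow> 'a list set" where
  "cyclic_walks X R =
     {c. c \<noteq> [] \<and> set c \<subseteq> X \<and> (\<forall>i<length c. R (c ! i) (c ! (Suc i mod length c)))}"

definition rotation_rel :: "('a list \<times> 'a list) set" where
  "rotation_rel = {(c, c'). \<exists>n. c' = rotate n c}"

text \<open>
  Primes of a directed graph with vertex set \<open>X\<close> and edge relation \<open>R\<close>. The primes of a hypergraph
  are the instance in which the vertices are the incident pairs \<open>(v, e)\<close>.
\<close>
definition prime_classes :: "'a set \<Rightarrow> ('a \<Rightarrow> 'a \<Rightarrow> bool) \<Rightarrow> 'a list set set" where
  "prime_classes X R = {c \<in> cyclic_walks X R. primitive_word c} // rotation_rel"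

lemma cyclic_walks_rotate:
  assumes "c \<in> cyclic_walks X R"
  shows "rotate n c \<in> cyclic_walks X R"
proof -
  have "R (rotate n c ! i) (rotate n c ! (Suc i mod length c))" if i: "i < length c" for i
  proof -
    have "rotate n c ! (Suc i mod length c) = c ! (Suc ((n + i) mod length c) mod length c)"
      using i by (subst nth_rotate) (auto simp: mod_simps intro!: mod_less_divisor)
    moreover have "rotate n c ! i = c ! ((n + i) mod length c)"
      using i by (subst nth_rotate) auto
    moreover have "(n + i) mod length c < length c"
      using i by (intro mod_less_divisor) auto
    ultimately show ?thesis
      using assms by (auto simp: cyclic_walks_def)
  qed
  then show ?thesis
    using assms by (auto simp: cyclic_walks_def)
qed

text \<open>
  A power and its base have the same set of consecutive pairs, read cyclically.
\<close>
lemma cyclic_walks_power_iff: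
  assumes "m \<ge> 1"
  shows "concat (replicate m b) \<in> cyclic_walks X R \<longleftrightarrow> b \<in> cyclic_walks X R"
proof (cases "b = []")
  case True
  then show ?thesis
    by (auto simp: cyclic_walks_def)
next
  case False
  let ?c = "concat (replicate m b)"
  have len: "length ?c = m * length b" and set: "set ?c = set b" and ne: "?c \<noteq> []"
    using assms False by (auto simp: length_concat_replicate)
  have step: "?c ! i = b ! (i mod length b) \<and>
      ?c ! (Suc i mod length ?c) = b ! (Suc (i mod length b) mod length b)" if "i < length ?c" for i
  proof -
    have "Suc i mod length ?c < m * length b"
      using mod_less_divisor[of "length ?c" "Suc i"] that len by linarith
    then have "?c ! (Suc i mod length ?c) = b ! (Suc i mod length b)"
      by (simp add: nth_concat_replicate len mod_mod_cancel)
    then show ?thesis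
      using that by (simp add: nth_concat_replicate len mod_Suc_eq)
  qed
  have le: "length b \<le> length ?c"
    using assms len by simp
  have "(\<forall>i<length ?c. R (?c ! i) (?c ! (Suc i mod length ?c))) \<longleftrightarrow>
        (\<forall>i<length b. R (b ! i) (b ! (Suc i mod length b)))"
    (is "?L \<longleftrightarrow> ?R")
  proof
    assume ?L
    show ?R
    proof (intro allI impI)
      fix i assume i: "i < length b"
      with \<open>?L\<close> le have "R (?c ! i) (?c ! (Suc i mod length ?c))" by simp
      with step[of i] i le show "R (b ! i) (b ! (Suc i mod length b))" by simp
    qed
  next
    assume ?R
    show ?L
    proof (intro allI impI)
      fix i assume i: "i < length ?c"
      have "i mod length b < length b" using False by simp
      with \<open>?R\<close> step[OF i] show "R (?c ! i) (?c ! (Suc i mod length ?c))" by simp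
    qed
  qed
  then show ?thesis
    unfolding cyclic_walks_def using set ne False by simp
qed

lemma equiv_rotation_rel: "equiv UNIV (rotation_rel :: ('a list \<times> 'a list) set)"
proof (intro equivI)
  show "refl (rotation_rel :: ('a list \<times> 'a list) set)"
    by (auto simp: refl_on_def rotation_rel_def intro: exI[of _ 0])
  show "sym (rotation_rel :: ('a list \<times> 'a list) set)"
  proof (rule symI)
    fix c c' :: "'a list"
    assume "(c, c') \<in> rotation_rel"
    then obtain n where "c' = rotate n c"
      by (auto simp: rotation_rel_def)
    moreover obtain k where "rotate k (rotate n c) = c"
      using rotate_inverse by blast
    ultimately show "(c', c) \<in> rotation_rel"
      by (auto simp: rotation_rel_def intro: exI[of _ k])
  qed
  show "trans (rotation_rel :: ('a list \<times> 'a list) set)"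
    by (auto simp: trans_def rotation_rel_def rotate_rotate)
qed simp

lemma prime_classesE:
  assumes "P \<in> prime_classes X R"
  obtains b where "b \<in> cyclic_walks X R" "primitive_word b" "P = rotation_rel `` {b}"
  using assms by (auto simp: prime_classes_def elim!: quotientE)

lemma prime_class_member:
  assumes "P \<in> prime_classes X R" "c \<in> P"
  shows "c \<in> cyclic_walks X R" "primitive_word c" "P = rotation_rel `` {c}"
proof -
  obtain b where b: "b \<in> cyclic_walks X R" "primitive_word b" "P = rotation_rel `` {b}"
    using assms(1) by (rule prime_classesE)
  then obtain n where "c = rotate n b"
    using assms(2) by (auto simp: rotation_rel_def)
  then show "c \<in> cyclic_walks X R" "primitive_word c"
    using b cyclic_walks_rotate primitive_word_rotate by blast+
  show "P = rotation_rel `` {c}"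
    using b assms(2) equiv_class_eq[OF equiv_rotation_rel, of b c] by auto
qed

text \<open>
  The rotations of a primitive word by less than its length are distinct. This is the factor that
  turns the weight \<open>1 / length\<close> of a closed walk into the coefficient \<open>1 / m\<close> of the logarithm.
\<close>
lemma card_prime_class:
  assumes "P \<in> prime_classes X R" "c \<in> P"
  shows "finite P" "card P = length c"
proof -
  have c: "primitive_word c" and P: "P = range (\<lambda>n. rotate n c)"
    using prime_class_member(2,3)[OF assms] by (simp_all add: rotation_rel_def Image_singleton full_SetCompr_eq)
  have pos: "length c > 0"
    using primitive_word_nonempty[OF c] by simp
  have img: "P = (\<lambda>n. rotate n c) ` {..<length c}"
    unfolding P
  proof (intro equalityI image_subsetI)
    fix n
    have "rotate n c = rotate (n mod length c) c"
      by (rule rotate_conv_mod)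
    moreover have "n mod length c \<in> {..<length c}"
      using pos by simp
    ultimately show "rotate n c \<in> (\<lambda>n. rotate n c) ` {..<length c}"
      by (rule image_eqI)
  qed (rule rangeI)
  have inj: "inj_on (\<lambda>n. rotate n c) {..<length c}"
  proof (rule linorder_inj_onI')
    fix i j
    assume ij: "i \<in> {..<length c}" "j \<in> {..<length c}" "i < j"
    show "rotate i c \<noteq> rotate j c"
    proof
      assume eq: "rotate i c = rotate j c"
      have "rotate (j - i) (rotate i c) = rotate j c"
        using ij by (simp add: rotate_rotate)
      then have "rotate (j - i) (rotate i c) = rotate i c"
        by (simp only: eq)
      then have "length c dvd j - i"
        using primitive_word_rotate_eq_iff[OF primitive_word_rotate[OF c, of i], of "j - i"] by simp
      then show False
        using ij by (auto dest: dvd_imp_le)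
    qed
  qed
  show "finite P" "card P = length c"
    using inj by (simp_all add: img card_image)
qed

lemma prime_length_eq:
  fixes c :: "('v \<times> 'e) list"
  assumes "P \<in> prime_classes X R" "c \<in> P"
  shows "prime_length P = length c"
proof -
  have "length ` P = {length c}"
    using prime_class_member(3)[OF assms] assms(2) by (auto simp: rotation_rel_def)
  then show ?thesis
    by (simp add: prime_length_def)
qed

lemma prime_class_nonempty: "P \<in> prime_classes X R \<Longrightarrow> P \<noteq> {}"
  unfolding prime_classes_def
  by (rule in_quotient_imp_non_empty[OF equiv_rotation_rel]) (auto simp: quotient_def)

lemma prime_length_pos:
  fixes X :: "('v \<times> 'e) set"
  assumes "P \<in> prime_classes X R"
  shows "prime_length P > 0"
proof -
  obtain c where c: "c \<in> P"
    using prime_class_nonempty[OF assms] by blast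
  show ?thesis
    using prime_length_eq[OF assms c] primitive_word_nonempty[OF prime_class_member(2)[OF assms c]]
    by simp
qed

text \<open>
  Existence and uniqueness of primitive roots: a cyclic walk is a power \<open>b\<^sup>m\<close> of a unique
  representative \<open>b\<close> of a unique prime.
\<close>
lemma bij_betw_prime_powers:
  "bij_betw (\<lambda>((P, m), b). concat (replicate m b))
     (Sigma (prime_classes X R \<times> {1..}) fst) (cyclic_walks X R)"
  unfolding bij_betw_def
proof
  show "inj_on (\<lambda>((P, m), b). concat (replicate m b)) (Sigma (prime_classes X R \<times> {1..}) fst)"
  proof (rule inj_onI)
    fix x y
    assume x: "x \<in> (Sigma (prime_classes X R \<times> {1..}) fst)"
      and y: "y \<in> (Sigma (prime_classes X R \<times> {1..}) fst)"
      and eq: "(\<lambda>((P, m), b). concat (replicate m b)) x = (\<lambda>((P, m), b). concat (replicate m b)) y"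
    obtain P m b where x_eq: "x = ((P, m), b)" and x: "P \<in> prime_classes X R" "m \<ge> 1" "b \<in> P"
      using x by (auto elim!: SigmaE)
    obtain Q k d where y_eq: "y = ((Q, k), d)" and y: "Q \<in> prime_classes X R" "k \<ge> 1" "d \<in> Q"
      using y by (auto elim!: SigmaE)
    have *: "b = d \<and> m = k"
      using eq prime_class_member(2)[OF x(1,3)] prime_class_member(2)[OF y(1,3)] x(2) y(2)
      by (intro primitive_root_unique) (simp_all add: x_eq y_eq)
    moreover have "P = Q"
    proof -
      have "P = rotation_rel `` {b}" "Q = rotation_rel `` {d}"
        by (rule prime_class_member(3)[OF x(1,3)], rule prime_class_member(3)[OF y(1,3)])
      moreover have "b = d"
        using * ..
      ultimately show ?thesis
        by (simp only:)
    qed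
    ultimately show "x = y"
      by (simp only: x_eq y_eq)
  qed
  show "(\<lambda>((P, m), b). concat (replicate m b)) ` (Sigma (prime_classes X R \<times> {1..}) fst)
      = cyclic_walks X R" (is "?h ` ?S = _")
  proof (intro equalityI subsetI)
    fix c assume "c \<in> ?h ` ?S"
    then obtain x where x: "x \<in> ?S" and "c = ?h x"
      by (rule imageE)
    then obtain P m b where "b \<in> P" "P \<in> prime_classes X R" "m \<ge> 1" "c = concat (replicate m b)"
      by (cases x) (auto split: prod.splits)
    then show "c \<in> cyclic_walks X R"
      using prime_class_member(1)[of P X R b] by (simp add: cyclic_walks_power_iff)
  next
    fix c assume c: "c \<in> cyclic_walks X R"
    then obtain b m where b: "m \<ge> 1" "primitive_word b" "c = concat (replicate m b)"
      using primitive_root_exists[of c] by (auto simp: cyclic_walks_def)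
    then have "b \<in> cyclic_walks X R"
      using c cyclic_walks_power_iff by blast
    then have "rotation_rel `` {b} \<in> prime_classes X R"
      using b by (auto simp: prime_classes_def intro!: quotientI)
    moreover have "b \<in> rotation_rel `` {b}"
      by (auto simp: rotation_rel_def intro: exI[of _ 0])
    ultimately show "c \<in> ?h ` ?S"
      using b by (intro image_eqI[of _ _ "((rotation_rel `` {b}, m), b)"]) auto
  qed
qed

section \<open>Determinants of regular incidence matrices\<close>

text \<open>
  Side conditions on dimensions, unlike membership in a \<^const>\<open>carrier_mat\<close> with unknown size, are
  discharged by rewriting.
\<close>
lemma mat_distrib_dims:
  fixes A B X :: "'a :: comm_ring_1 mat"
  shows "dim_col A = dim_row B \<Longrightarrow> (k \<cdot>\<^sub>m A) * B = k \<cdot>\<^sub>m (A * B)"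
    and "dim_col A = dim_row B \<Longrightarrow> A * (k \<cdot>\<^sub>m B) = k \<cdot>\<^sub>m (A * B)"
    and "dim_row A = dim_row B \<Longrightarrow> dim_col A = dim_col B \<Longrightarrow> dim_col A = dim_row X \<Longrightarrow>
      (A + B) * X = A * X + B * X"
    and "dim_row A = dim_row B \<Longrightarrow> dim_col A = dim_col B \<Longrightarrow> dim_col A = dim_row X \<Longrightarrow>
      (A - B) * X = A * X - B * X"
    and "dim_row A = dim_row B \<Longrightarrow> dim_col A = dim_col B \<Longrightarrow> dim_col X = dim_row A \<Longrightarrow>
      X * (A + B) = X * A + X * B"
    and "dim_row A = dim_row B \<Longrightarrow> dim_col A = dim_col B \<Longrightarrow> dim_col X = dim_row A \<Longrightarrow>
      X * (A - B) = X * A - X * B"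
    and "dim_col A = dim_row B \<Longrightarrow> dim_col B = dim_row X \<Longrightarrow> A * B * X = A * (B * X)"
proof -
  show "dim_col A = dim_row B \<Longrightarrow> (k \<cdot>\<^sub>m A) * B = k \<cdot>\<^sub>m (A * B)"
    by (rule mult_smult_assoc_mat[of A "dim_row A" "dim_col A" B "dim_col B"]) auto
  show "dim_col A = dim_row B \<Longrightarrow> A * (k \<cdot>\<^sub>m B) = k \<cdot>\<^sub>m (A * B)"
    by (rule mult_smult_distrib[of A "dim_row A" "dim_col A" B "dim_col B"]) auto
  show "dim_row A = dim_row B \<Longrightarrow> dim_col A = dim_col B \<Longrightarrow> dim_col A = dim_row X \<Longrightarrow>
      (A + B) * X = A * X + B * X"
    by (rule add_mult_distrib_mat[of A "dim_row A" "dim_col A" B X "dim_col X"]) auto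
  show "dim_row A = dim_row B \<Longrightarrow> dim_col A = dim_col B \<Longrightarrow> dim_col A = dim_row X \<Longrightarrow>
      (A - B) * X = A * X - B * X"
    by (rule minus_mult_distrib_mat[of A "dim_row A" "dim_col A" B X "dim_col X"]) auto
  show "dim_row A = dim_row B \<Longrightarrow> dim_col A = dim_col B \<Longrightarrow> dim_col X = dim_row A \<Longrightarrow>
      X * (A + B) = X * A + X * B"
    by (rule mult_add_distrib_mat[of X "dim_row X" "dim_col X" A "dim_col A" B]) auto
  show "dim_row A = dim_row B \<Longrightarrow> dim_col A = dim_col B \<Longrightarrow> dim_col X = dim_row A \<Longrightarrow>
      X * (A - B) = X * A - X * B"
    by (rule mult_minus_distrib_mat[of X "dim_row X" "dim_col X" A "dim_col A" B]) auto
  show "dim_col A = dim_row B \<Longrightarrow> dim_col B = dim_row X \<Longrightarrow> A * B * X = A * (B * X)"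
    by (rule assoc_mult_mat[of A "dim_row A" "dim_col A" B "dim_col B" X "dim_col X"]) auto
qed

text \<open>
  The block matrix with rows \<open>(1, -A)\<close> and \<open>(B, 1)\<close> has a lower-upper and an upper-lower block
  triangular factorization; each of the two determinants appears in one of them.
\<close>
lemma det_one_plus_mult_commute:
  fixes A B :: "'a :: idom mat"
  assumes A: "A \<in> carrier_mat m n" and B: "B \<in> carrier_mat n m"
  shows "det (1\<^sub>m m + A * B) = det (1\<^sub>m n + B * A)"
proof -
  let ?M = "four_block_mat (1\<^sub>m m) (- A) B (1\<^sub>m n)"
  let ?L = "four_block_mat (1\<^sub>m m) (0\<^sub>m m n) B (1\<^sub>m n)"
  have L: "?L \<in> carrier_mat (m + n) (m + n)"
    by simp
  have "?M = ?L * four_block_mat (1\<^sub>m m) (- A) (0\<^sub>m n m) (1\<^sub>m n + B * A)"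
    using A B by (subst mult_four_block_mat[of _ m m _ n _ n])
      (auto intro!: cong_four_block_mat eq_matI)
  then have "det ?M = det ?L * det (four_block_mat (1\<^sub>m m) (- A) (0\<^sub>m n m) (1\<^sub>m n + B * A))"
    using L A B by (simp add: det_mult[of _ "m + n"])
  also have "\<dots> = det (1\<^sub>m n + B * A)"
    using A B by (simp add: det_four_block_mat_upper_right_zero[of _ m _ n]
        det_four_block_mat_lower_left_zero[of _ m _ n])
  finally have 1: "det ?M = det (1\<^sub>m n + B * A)" .
  have "?M = four_block_mat (1\<^sub>m m + A * B) (- A) (0\<^sub>m n m) (1\<^sub>m n) * ?L"
    using A B by (subst mult_four_block_mat[of _ m m _ n _ n])
      (auto intro!: cong_four_block_mat eq_matI)
  then have "det ?M = det (four_block_mat (1\<^sub>m m + A * B) (- A) (0\<^sub>m n m) (1\<^sub>m n)) * det ?L"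
    using L A B by (simp add: det_mult[of _ "m + n"])
  also have "\<dots> = det (1\<^sub>m m + A * B)"
    using A B by (simp add: det_four_block_mat_upper_right_zero[of _ m _ n]
        det_four_block_mat_lower_left_zero[of _ m _ n])
  finally show ?thesis
    using 1 by simp
qed

lemma det_smult_one_plus_mult_commute:
  fixes A B :: "'a :: field mat"
  assumes A: "A \<in> carrier_mat m n" and B: "B \<in> carrier_mat n m" and c: "c \<noteq> 0"
  shows "c ^ n * det (c \<cdot>\<^sub>m 1\<^sub>m m + A * B) = c ^ m * det (c \<cdot>\<^sub>m 1\<^sub>m n + B * A)"
proof -
  let ?A = "inverse c \<cdot>\<^sub>m A"
  have A': "?A \<in> carrier_mat m n"
    using A by simp
  have 1: "c \<cdot>\<^sub>m 1\<^sub>m m + A * B = c \<cdot>\<^sub>m (1\<^sub>m m + ?A * B)"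
    using A B c by (intro eq_matI) (auto simp: distrib_left)
  have 2: "c \<cdot>\<^sub>m 1\<^sub>m n + B * A = c \<cdot>\<^sub>m (1\<^sub>m n + B * ?A)"
    using A B c by (intro eq_matI) (auto simp: distrib_left mult_smult_distrib[of _ n m _ n])
  show ?thesis
    unfolding 1 2 using A B by (simp add: det_smult det_one_plus_mult_commute[OF A' B])
qed

text \<open>
  Bass's formula for a biregular bipartite graph. Here \<open>C\<close> and \<open>S\<close> are the incidence matrices of the
  edges of the graph with the two classes of vertices and \<open>T = (C C\<^sup>T - 1) (S S\<^sup>T - 1)\<close>. In terms of
  \<open>P = C C\<^sup>T\<close> and \<open>R = S S\<^sup>T\<close>,
  \<open>1 - u T = ((1 - u) + u P) + u (1 - P) R\<close>,
  and since \<open>P\<^sup>2 = r P\<close> the factor \<open>L = (1 - u) + u P\<close> can be split off: \<open>u (1 - P) = L X\<close> with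
  \<open>X\<close> a combination of \<open>1\<close> and \<open>P\<close>, so \<open>1 - u T = L (1 + X R)\<close>. Both factors are a multiple of the
  identity plus a product through a smaller space, so exchanging the order of multiplication reduces
  \<open>det L\<close> to a scalar matrix of size \<open>n\<^sub>2\<close> and the other determinant to one of size \<open>n\<^sub>1\<close>.
\<close>
lemma det_regular_incidence:
  fixes C S T :: "'a :: field mat" and u r d :: 'a
  assumes C: "C \<in> carrier_mat N n\<^sub>2" and S: "S \<in> carrier_mat N n\<^sub>1" and T: "T \<in> carrier_mat N N"
    and CC: "transpose_mat C * C = r \<cdot>\<^sub>m 1\<^sub>m n\<^sub>2" and SS: "transpose_mat S * S = d \<cdot>\<^sub>m 1\<^sub>m n\<^sub>1"
    and T_entry: "\<And>i j. i < N \<Longrightarrow> j < N \<Longrightarrow> T $$ (i, j) =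
      (C * transpose_mat C * (S * transpose_mat S)) $$ (i, j) - (C * transpose_mat C) $$ (i, j)
      - (S * transpose_mat S) $$ (i, j) + (if i = j then 1 else 0)"
  defines "K \<equiv> transpose_mat S * (C * transpose_mat C) * S"
    and "\<alpha> \<equiv> 1 + (r - 1) * u" and "\<beta> \<equiv> 1 + (d - 1) * u"
  assumes u: "u \<noteq> 1" and \<alpha>: "\<alpha> \<noteq> 0"
  shows "(1 - u) ^ (n\<^sub>1 + n\<^sub>2) * \<alpha> ^ n\<^sub>1 * det (1\<^sub>m N - u \<cdot>\<^sub>m T) =
    (1 - u) ^ N * \<alpha> ^ n\<^sub>2 * det ((\<alpha> * \<beta>) \<cdot>\<^sub>m 1\<^sub>m n\<^sub>1 - u \<cdot>\<^sub>m K)"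
proof -
  define P where "P = C * transpose_mat C"
  define R where "R = S * transpose_mat S"
  have P: "P \<in> carrier_mat N N" and R: "R \<in> carrier_mat N N"
    using C S by (simp_all add: P_def R_def)
  have PP: "P * P = r \<cdot>\<^sub>m P"
  proof -
    have "P * P = C * (transpose_mat C * C) * transpose_mat C"
      using C unfolding P_def by (simp add: mat_distrib_dims)
    also have "\<dots> = r \<cdot>\<^sub>m P"
      unfolding CC P_def using C by (simp add: mat_distrib_dims)
    finally show ?thesis .
  qed
  \<comment> \<open>\<open>x\<close> and \<open>y\<close> solve \<open>((1 - u) + u P) (x + y P) = u - u P\<close>, by comparing the coefficients of \<open>1\<close> and \<open>P\<close>.\<close>
  define x where "x = u / (1 - u)"
  define y where "y = - u / ((1 - u) * \<alpha>)"
  define L where "L = (1 - u) \<cdot>\<^sub>m 1\<^sub>m N + u \<cdot>\<^sub>m P"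
  define X where "X = x \<cdot>\<^sub>m 1\<^sub>m N + y \<cdot>\<^sub>m P"
  have L: "L \<in> carrier_mat N N" and X: "X \<in> carrier_mat N N"
    using P by (simp_all add: L_def X_def)
  have xy: "(1 - u) * x = u" "(1 - u) * y + u * (x + y * r) = - u"
  proof -
    show "(1 - u) * x = u"
      using u by (simp add: x_def)
    have "(1 - u) * y + u * (x + y * r) = y * \<alpha> + u * x"
      by (simp add: \<alpha>_def algebra_simps)
    also have "\<dots> = - u / (1 - u) + u * u / (1 - u)"
      using u \<alpha> by (simp add: x_def y_def)
    also have "\<dots> = - u * (1 - u) / (1 - u)"
      by (simp add: right_diff_distrib flip: diff_divide_distrib)
    also have "\<dots> = - u"
      using u by simp
    finally show "(1 - u) * y + u * (x + y * r) = - u" .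
  qed
  have LX: "L * X = u \<cdot>\<^sub>m 1\<^sub>m N - u \<cdot>\<^sub>m P"
  proof -
    have "L * X = (1 - u) \<cdot>\<^sub>m X + u \<cdot>\<^sub>m (P * X)"
      unfolding L_def using P X
      by (simp add: mat_distrib_dims)
    also have "P * X = x \<cdot>\<^sub>m P + y \<cdot>\<^sub>m (r \<cdot>\<^sub>m P)"
      unfolding X_def using P
      by (simp add: mat_distrib_dims PP)
    also have "(1 - u) \<cdot>\<^sub>m X + u \<cdot>\<^sub>m (x \<cdot>\<^sub>m P + y \<cdot>\<^sub>m (r \<cdot>\<^sub>m P)) = u \<cdot>\<^sub>m 1\<^sub>m N - u \<cdot>\<^sub>m P"
    proof (rule eq_matI)
      fix i j assume "i < dim_row (u \<cdot>\<^sub>m 1\<^sub>m N - u \<cdot>\<^sub>m P)" "j < dim_col (u \<cdot>\<^sub>m 1\<^sub>m N - u \<cdot>\<^sub>m P)"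
      then have ij: "i < N" "j < N"
        using P by auto
      let ?\<delta> = "if i = j then 1 else 0 :: 'a" and ?p = "P $$ (i, j)"
      have "((1 - u) \<cdot>\<^sub>m X + u \<cdot>\<^sub>m (x \<cdot>\<^sub>m P + y \<cdot>\<^sub>m (r \<cdot>\<^sub>m P))) $$ (i, j) =
          ((1 - u) * x) * ?\<delta> + ((1 - u) * y + u * (x + y * r)) * ?p"
        unfolding X_def using ij P by (simp add: algebra_simps)
      also have "\<dots> = (u \<cdot>\<^sub>m 1\<^sub>m N - u \<cdot>\<^sub>m P) $$ (i, j)"
        unfolding xy using ij P by simp
      finally show "((1 - u) \<cdot>\<^sub>m X + u \<cdot>\<^sub>m (x \<cdot>\<^sub>m P + y \<cdot>\<^sub>m (r \<cdot>\<^sub>m P))) $$ (i, j) =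
        (u \<cdot>\<^sub>m 1\<^sub>m N - u \<cdot>\<^sub>m P) $$ (i, j)" .
    qed (use P in \<open>auto simp: X_def\<close>)
    finally show ?thesis .
  qed
  have factor: "1\<^sub>m N - u \<cdot>\<^sub>m T = L * (1\<^sub>m N + X * S * transpose_mat S)"
  proof -
    have "L * (1\<^sub>m N + X * S * transpose_mat S) = L + (L * X) * R"
      unfolding R_def using L X S
      by (simp add: mat_distrib_dims)
    also have "\<dots> = L + (u \<cdot>\<^sub>m R - u \<cdot>\<^sub>m (P * R))"
      unfolding LX using P R by (simp add: mat_distrib_dims)
    also have "\<dots> = 1\<^sub>m N - u \<cdot>\<^sub>m T"
    proof (rule eq_matI)
      fix i j assume "i < dim_row (1\<^sub>m N - u \<cdot>\<^sub>m T)" "j < dim_col (1\<^sub>m N - u \<cdot>\<^sub>m T)"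
      then have ij: "i < N" "j < N"
        using T by auto
      have "(L + (u \<cdot>\<^sub>m R - u \<cdot>\<^sub>m (P * R))) $$ (i, j) = (if i = j then 1 else 0) -
          u * ((P * R) $$ (i, j) - P $$ (i, j) - R $$ (i, j) + (if i = j then 1 else 0))"
        unfolding L_def using ij P R by (simp add: algebra_simps del: index_mult_mat(1))
      then show "(L + (u \<cdot>\<^sub>m R - u \<cdot>\<^sub>m (P * R))) $$ (i, j) = (1\<^sub>m N - u \<cdot>\<^sub>m T) $$ (i, j)"
        using ij T by (simp add: T_entry[OF ij] P_def R_def del: index_mult_mat(1))
    qed (use T P R in \<open>auto simp: L_def\<close>)
    finally show ?thesis ..
  qed
  have det_L: "(1 - u) ^ n\<^sub>2 * det L = (1 - u) ^ N * \<alpha> ^ n\<^sub>2"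
  proof -
    have L_eq: "L = (1 - u) \<cdot>\<^sub>m 1\<^sub>m N + (u \<cdot>\<^sub>m C) * transpose_mat C"
      unfolding L_def P_def using C by (simp add: mat_distrib_dims)
    have "(1 - u) ^ n\<^sub>2 * det L =
        (1 - u) ^ N * det ((1 - u) \<cdot>\<^sub>m 1\<^sub>m n\<^sub>2 + transpose_mat C * (u \<cdot>\<^sub>m C))"
      unfolding L_eq using C u by (intro det_smult_one_plus_mult_commute) simp_all
    also have "(1 - u) \<cdot>\<^sub>m 1\<^sub>m n\<^sub>2 + transpose_mat C * (u \<cdot>\<^sub>m C) = \<alpha> \<cdot>\<^sub>m 1\<^sub>m n\<^sub>2"
    proof -
      have "transpose_mat C * (u \<cdot>\<^sub>m C) = u \<cdot>\<^sub>m (r \<cdot>\<^sub>m 1\<^sub>m n\<^sub>2)"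
        using C by (simp add: mat_distrib_dims CC)
      then show ?thesis
        by (auto intro!: eq_matI simp: \<alpha>_def algebra_simps)
    qed
    finally show ?thesis
      by (simp add: det_smult)
  qed
  let ?Y = "1\<^sub>m n\<^sub>1 + transpose_mat S * (X * S)"
  have K: "K \<in> carrier_mat n\<^sub>1 n\<^sub>1"
    unfolding K_def by (rule carrier_matI) (use S in simp_all)
  have SXS: "transpose_mat S * (X * S) = (x * d) \<cdot>\<^sub>m 1\<^sub>m n\<^sub>1 + y \<cdot>\<^sub>m K"
  proof -
    have "X * S = x \<cdot>\<^sub>m S + y \<cdot>\<^sub>m (P * S)"
      unfolding X_def using P S by (simp add: mat_distrib_dims)
    then have "transpose_mat S * (X * S) =
        x \<cdot>\<^sub>m (transpose_mat S * S) + y \<cdot>\<^sub>m (transpose_mat S * (P * S))"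
      using P S by (simp add: mat_distrib_dims)
    moreover have "transpose_mat S * (P * S) = K"
      unfolding K_def P_def[symmetric] using P S by (simp add: mat_distrib_dims)
    ultimately show ?thesis
      unfolding SS using K by (auto intro!: eq_matI)
  qed
  have det_Y: "((1 - u) * \<alpha>) ^ n\<^sub>1 * det ?Y = det ((\<alpha> * \<beta>) \<cdot>\<^sub>m 1\<^sub>m n\<^sub>1 - u \<cdot>\<^sub>m K)"
  proof -
    have coeff: "(1 - u) * \<alpha> * (1 + x * d) = \<alpha> * \<beta>" "(1 - u) * \<alpha> * y = - u"
    proof -
      have "(1 - u) * \<alpha> * (1 + x * d) = \<alpha> * ((1 - u) + ((1 - u) * x) * d)"
        by (simp add: algebra_simps)
      then show "(1 - u) * \<alpha> * (1 + x * d) = \<alpha> * \<beta>"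
        unfolding xy by (simp add: \<beta>_def algebra_simps)
    qed (use u \<alpha> in \<open>simp add: y_def\<close>)
    have "((1 - u) * \<alpha>) \<cdot>\<^sub>m ?Y = (\<alpha> * \<beta>) \<cdot>\<^sub>m 1\<^sub>m n\<^sub>1 - u \<cdot>\<^sub>m K"
    proof (rule eq_matI)
      fix i j assume "i < dim_row ((\<alpha> * \<beta>) \<cdot>\<^sub>m 1\<^sub>m n\<^sub>1 - u \<cdot>\<^sub>m K)" "j < dim_col ((\<alpha> * \<beta>) \<cdot>\<^sub>m 1\<^sub>m n\<^sub>1 - u \<cdot>\<^sub>m K)"
      then have ij: "i < n\<^sub>1" "j < n\<^sub>1"
        using K by auto
      have "(((1 - u) * \<alpha>) \<cdot>\<^sub>m ?Y) $$ (i, j) =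
          ((1 - u) * \<alpha> * (1 + x * d)) * (if i = j then 1 else 0) + ((1 - u) * \<alpha> * y) * K $$ (i, j)"
        unfolding SXS using ij K by (simp add: algebra_simps)
      also have "\<dots> = ((\<alpha> * \<beta>) \<cdot>\<^sub>m 1\<^sub>m n\<^sub>1 - u \<cdot>\<^sub>m K) $$ (i, j)"
        unfolding coeff using ij K by simp
      finally show "(((1 - u) * \<alpha>) \<cdot>\<^sub>m ?Y) $$ (i, j) = ((\<alpha> * \<beta>) \<cdot>\<^sub>m 1\<^sub>m n\<^sub>1 - u \<cdot>\<^sub>m K) $$ (i, j)" .
    qed (use K SXS in auto)
    then have "det ((\<alpha> * \<beta>) \<cdot>\<^sub>m 1\<^sub>m n\<^sub>1 - u \<cdot>\<^sub>m K) = det (((1 - u) * \<alpha>) \<cdot>\<^sub>m ?Y)"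
      by simp
    also have "\<dots> = ((1 - u) * \<alpha>) ^ n\<^sub>1 * det ?Y"
      using S by (simp add: det_smult)
    finally show ?thesis ..
  qed
  have "det (1\<^sub>m N - u \<cdot>\<^sub>m T) = det L * det (1\<^sub>m N + X * S * transpose_mat S)"
    unfolding factor using L X S by (simp add: det_mult[of _ N])
  also have "det (1\<^sub>m N + X * S * transpose_mat S) = det ?Y"
    using X S by (intro det_one_plus_mult_commute) simp_all
  finally have "(1 - u) ^ (n\<^sub>1 + n\<^sub>2) * \<alpha> ^ n\<^sub>1 * det (1\<^sub>m N - u \<cdot>\<^sub>m T) =
      ((1 - u) ^ n\<^sub>2 * det L) * (((1 - u) * \<alpha>) ^ n\<^sub>1 * det ?Y)"
    by (simp add: power_add power_mult_distrib)
  then show ?thesis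
    unfolding det_L det_Y .
qed

text \<open>
  With \<open>w = 1 / (q u)\<close> the quadratic \<open>(1 + (r - 1) u) (1 + (d - 1) u)\<close> has leading coefficient \<open>q\<close> and
  constant coefficient \<open>1\<close>, so it is \<open>q u\<^sup>2\<close> times its value at \<open>w\<close>; as also \<open>u = q u\<^sup>2 w\<close>, the
  whole matrix is \<open>q u\<^sup>2\<close> times the one at \<open>w\<close>.
\<close>
lemma det_functional_equation:
  fixes K :: "'a :: field mat" and r d q u :: 'a
  assumes K: "K \<in> carrier_mat n n" and q: "q = (d - 1) * (r - 1)" "q \<noteq> 0" and u: "u \<noteq> 0"
  defines "D \<equiv> \<lambda>u. det (((1 + (r - 1) * u) * (1 + (d - 1) * u)) \<cdot>\<^sub>m 1\<^sub>m n - u \<cdot>\<^sub>m K)"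
  shows "D u = (q * u\<^sup>2) ^ n * D (1 / (q * u))"
proof -
  define w where "w = 1 / (q * u)"
  have w: "q * u\<^sup>2 * w = u" "q * u * w = 1"
    using q u by (simp_all add: w_def power2_eq_square)
  have "(1 + (r - 1) * u) * (1 + (d - 1) * u) = 1 + (r - 1 + (d - 1)) * u + q * u\<^sup>2"
    by (simp add: q power2_eq_square algebra_simps)
  also have "\<dots> = q * u\<^sup>2 + (r - 1 + (d - 1)) * (q * u\<^sup>2 * w) + (q * u * w)\<^sup>2 * 1"
    by (simp add: w)
  also have "\<dots> = q * u\<^sup>2 * (1 + (r - 1 + (d - 1)) * w + q * w\<^sup>2)"
    by (simp add: algebra_simps power2_eq_square)
  also have "1 + (r - 1 + (d - 1)) * w + q * w\<^sup>2 = (1 + (r - 1) * w) * (1 + (d - 1) * w)"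
    by (simp add: q power2_eq_square algebra_simps)
  finally have scalar: "(1 + (r - 1) * u) * (1 + (d - 1) * u) =
      q * u\<^sup>2 * ((1 + (r - 1) * w) * (1 + (d - 1) * w))" .
  have "((1 + (r - 1) * u) * (1 + (d - 1) * u)) \<cdot>\<^sub>m 1\<^sub>m n - u \<cdot>\<^sub>m K =
      (q * u\<^sup>2) \<cdot>\<^sub>m (((1 + (r - 1) * w) * (1 + (d - 1) * w)) \<cdot>\<^sub>m 1\<^sub>m n - w \<cdot>\<^sub>m K)"
  proof (rule eq_matI)
    fix i j
    let ?rhs = "(q * u\<^sup>2) \<cdot>\<^sub>m (((1 + (r - 1) * w) * (1 + (d - 1) * w)) \<cdot>\<^sub>m 1\<^sub>m n - w \<cdot>\<^sub>m K)"
    assume "i < dim_row ?rhs" "j < dim_col ?rhs"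
    then have ij: "i < n" "j < n"
      using K by auto
    have "?rhs $$ (i, j) = q * u\<^sup>2 * ((1 + (r - 1) * w) * (1 + (d - 1) * w)) * (if i = j then 1 else 0)
        - (q * u\<^sup>2 * w) * K $$ (i, j)"
      using ij K by (simp add: algebra_simps)
    then show "(((1 + (r - 1) * u) * (1 + (d - 1) * u)) \<cdot>\<^sub>m 1\<^sub>m n - u \<cdot>\<^sub>m K) $$ (i, j) = ?rhs $$ (i, j)"
      unfolding w scalar[symmetric] using ij K by simp
  qed (use K in auto)
  then show ?thesis
    using K unfolding D_def w_def[symmetric] by (simp add: det_smult)
qed

section \<open>Traces of powers\<close>

definition trace_mat :: "'a :: comm_monoid_add mat \<Rightarrow> 'a" where
  "trace_mat A = (\<Sum>i<dim_row A. A $$ (i, i))"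

lemma trace_mult_commute:
  fixes A B :: "'a :: comm_semiring_0 mat"
  assumes "A \<in> carrier_mat m n" "B \<in> carrier_mat n m"
  shows "trace_mat (A * B) = trace_mat (B * A)"
proof -
  have "trace_mat (A * B) = (\<Sum>i<m. \<Sum>j<n. A $$ (i, j) * B $$ (j, i))"
    using assms by (auto simp: trace_mat_def scalar_prod_def atLeast0LessThan intro!: sum.cong)
  also have "\<dots> = (\<Sum>j<n. \<Sum>i<m. B $$ (j, i) * A $$ (i, j))"
    by (subst sum.swap) (simp add: mult.commute)
  also have "\<dots> = trace_mat (B * A)"
    using assms by (auto simp: trace_mat_def scalar_prod_def atLeast0LessThan intro!: sum.cong)
  finally show ?thesis .
qed

lemma upper_triangular_mult:
  fixes A B :: "'a :: comm_semiring_0 mat"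
  assumes A: "A \<in> carrier_mat n n" "upper_triangular A"
    and B: "B \<in> carrier_mat n n" "upper_triangular B"
  shows "upper_triangular (A * B)" "i < n \<Longrightarrow> (A * B) $$ (i, i) = A $$ (i, i) * B $$ (i, i)"
proof -
  have entry: "(A * B) $$ (i, j) = (if i = j then A $$ (i, i) * B $$ (i, i) else 0)"
    if ij: "j \<le> i" "i < n" for i j
  proof -
    have "(A * B) $$ (i, j) = (\<Sum>k<n. A $$ (i, k) * B $$ (k, j))"
      using ij A B by (simp add: scalar_prod_def atLeast0LessThan)
    also have "\<dots> = (\<Sum>k<n. if k = i then if i = j then A $$ (i, i) * B $$ (i, i) else 0 else 0)"
    proof (rule sum.cong[OF refl])
      fix k assume "k \<in> {..<n}"
      then show "A $$ (i, k) * B $$ (k, j) =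
          (if k = i then if i = j then A $$ (i, i) * B $$ (i, i) else 0 else 0)"
        using ij A B upper_triangularD[OF A(2), of k i] upper_triangularD[OF B(2), of j k]
        by (cases k i rule: linorder_cases) auto
    qed
    also have "\<dots> = (if i = j then A $$ (i, i) * B $$ (i, i) else 0)"
      using ij by (subst sum.delta) auto
    finally show ?thesis .
  qed
  show "upper_triangular (A * B)"
    using A B entry by (auto simp: upper_triangular_def)
  show "i < n \<Longrightarrow> (A * B) $$ (i, i) = A $$ (i, i) * B $$ (i, i)"
    using entry[of i i] by simp
qed

lemma upper_triangular_pow:
  fixes A :: "'a :: comm_semiring_1 mat"
  assumes A: "A \<in> carrier_mat n n" "upper_triangular A"
  shows "upper_triangular (A ^\<^sub>m k) \<and> (\<forall>i<n. (A ^\<^sub>m k) $$ (i, i) = (A $$ (i, i)) ^ k)"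
proof (induction k)
  case 0
  then show ?case
    using A by (auto simp: upper_triangular_def)
next
  case (Suc k)
  have "A ^\<^sub>m k \<in> carrier_mat n n"
    using A by simp
  with Suc show ?case
    using upper_triangular_mult[of "A ^\<^sub>m k" n A] A by (simp add: mult.commute)
qed

text \<open>
  The \<open>b i\<close> are the eigenvalues with multiplicity: the diagonal of a triangular matrix similar to \<open>A\<close>.
\<close>
lemma eigenvalues_trace_det:
  fixes A :: "complex mat"
  assumes A: "A \<in> carrier_mat n n"
  obtains b :: "nat \<Rightarrow> complex" where
    "\<And>k. trace_mat (A ^\<^sub>m k) = (\<Sum>i<n. b i ^ k)"
    "\<And>u. det (1\<^sub>m n - u \<cdot>\<^sub>m A) = (\<Prod>i<n. 1 - b i * u)"
proof -
  obtain es where "char_poly A = (\<Prod>a\<leftarrow>es. [:- a, 1:])"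
    using char_poly_factorized[OF A] by blast
  then obtain B where B: "B \<in> carrier_mat n n" "upper_triangular B" "similar_mat A B"
    using schur_decomposition_exists[OF A] by blast
  then obtain P Q where wit: "similar_mat_wit A B P Q"
    by (auto simp: similar_mat_def)
  then have PQ: "P \<in> carrier_mat n n" "Q \<in> carrier_mat n n" "P * Q = 1\<^sub>m n" "Q * P = 1\<^sub>m n"
    and AB: "A = P * B * Q"
    using similar_mat_witD2[OF A wit] by auto
  have "trace_mat (A ^\<^sub>m k) = (\<Sum>i<n. (B $$ (i, i)) ^ k)" for k
  proof -
    have Bk: "B ^\<^sub>m k \<in> carrier_mat n n"
      using B by simp
    have "trace_mat (A ^\<^sub>m k) = trace_mat (P * (B ^\<^sub>m k * Q))"
      using similar_mat_wit_pow_id[OF wit] PQ Bk by (simp add: assoc_mult_mat[of _ n n _ n _ n])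
    also have "\<dots> = trace_mat (B ^\<^sub>m k * Q * P)"
      using PQ Bk by (intro trace_mult_commute[of _ n n]) simp_all
    also have "\<dots> = trace_mat (B ^\<^sub>m k)"
      using PQ B(1) by (simp add: mat_distrib_dims)
    also have "\<dots> = (\<Sum>i<n. (B $$ (i, i)) ^ k)"
      using upper_triangular_pow[OF B(1,2), of k] B(1) by (simp add: trace_mat_def)
    finally show ?thesis .
  qed
  moreover have "det (1\<^sub>m n - u \<cdot>\<^sub>m A) = (\<Prod>i<n. 1 - B $$ (i, i) * u)" for u
  proof -
    have uB: "1\<^sub>m n - u \<cdot>\<^sub>m B \<in> carrier_mat n n"
      using B by (intro minus_carrier_mat) simp
    have "P * (1\<^sub>m n - u \<cdot>\<^sub>m B) * Q = 1\<^sub>m n - u \<cdot>\<^sub>m A"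
      unfolding AB using PQ B(1) by (simp add: mat_distrib_dims)
    then have "det (1\<^sub>m n - u \<cdot>\<^sub>m A) = det P * det (1\<^sub>m n - u \<cdot>\<^sub>m B) * det Q"
      using PQ uB by (metis det_mult mult_carrier_mat)
    also have "\<dots> = det (P * Q) * det (1\<^sub>m n - u \<cdot>\<^sub>m B)"
      using PQ(1,2) by (simp add: det_mult[of _ n])
    also have "\<dots> = det (1\<^sub>m n - u \<cdot>\<^sub>m B)"
      using PQ by simp
    also have "\<dots> = prod_list (diag_mat (1\<^sub>m n - u \<cdot>\<^sub>m B))"
      using B uB by (intro det_upper_triangular[of _ n]) (auto simp: upper_triangular_def)
    also have "\<dots> = (\<Prod>i<n. 1 - B $$ (i, i) * u)"
      using B by (auto simp: prod_list_diag_prod atLeast0LessThan mult.commute intro!: prod.cong)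
    finally show ?thesis .
  qed
  ultimately show ?thesis
    by (rule that)
qed

section \<open>Counting cyclic walks by traces\<close>

text \<open>
  Walks with \<open>k\<close> steps from \<open>x\<close> to \<open>y\<close>, listed without the start \<open>x\<close>. A closed walk is then listed
  exactly as the cyclic walk that it traverses, ending at its last entry.
\<close>
definition walks :: "'a set \<Rightarrow> ('a \<Rightarrow> 'a \<Rightarrow> bool) \<Rightarrow> nat \<Rightarrow> 'a \<Rightarrow> 'a \<Rightarrow> 'a list set" where
  "walks X R k x y =
     {c. length c = k \<and> set c \<subseteq> X \<and> successively R (x # c) \<and> last (x # c) = y}"

definition adjacency_mat :: "(nat \<Rightarrow> 'a) \<Rightarrow> nat \<Rightarrow> ('a \<Rightarrow> 'a \<Rightarrow> bool) \<Rightarrow> complex mat" where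
  "adjacency_mat f n R = mat n n (\<lambda>(i, j). of_bool (R (f i) (f j)))"

lemma finite_walks: "finite X \<Longrightarrow> finite (walks X R k x y)"
  by (rule finite_subset[OF _ finite_lists_length_eq[of X k]]) (auto simp: walks_def)

lemma walks_Suc:
  assumes "x \<in> X" "y \<in> X"
  shows "walks X R (Suc k) x y = (\<Union>z\<in>{z\<in>X. R z y}. (\<lambda>c. c @ [y]) ` walks X R k x z)"
proof (intro equalityI subsetI)
  fix c assume c: "c \<in> walks X R (Suc k) x y"
  then obtain c' w where cw: "c = c' @ [w]"
    by (cases c rule: rev_cases) (auto simp: walks_def)
  with c have "w = y"
    by (simp add: walks_def)
  have "successively R ((x # c') @ [y])"
    using c by (simp add: walks_def cw \<open>w = y\<close>)
  then have "successively R (x # c')" "R (last (x # c')) y"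
    unfolding successively_append_iff by auto
  moreover have "last (x # c') \<in> X"
    using c assms(1) by (auto simp: walks_def cw)
  moreover have "length c' = k" "set c' \<subseteq> X"
    using c by (simp_all add: walks_def cw)
  ultimately show "c \<in> (\<Union>z\<in>{z\<in>X. R z y}. (\<lambda>c. c @ [y]) ` walks X R k x z)"
    unfolding cw \<open>w = y\<close> walks_def by blast
next
  fix c assume "c \<in> (\<Union>z\<in>{z\<in>X. R z y}. (\<lambda>c. c @ [y]) ` walks X R k x z)"
  then obtain c' where "R (last (x # c')) y" "c = c' @ [y]" "length c' = k" "set c' \<subseteq> X"
    "successively R (x # c')"
    unfolding walks_def by blast
  moreover from this have "successively R ((x # c') @ [y])"
    unfolding successively_append_iff by simp
  ultimately show "c \<in> walks X R (Suc k) x y"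
    using assms(2) by (simp add: walks_def)
qed

lemma card_walks_Suc:
  assumes "finite X" "x \<in> X" "y \<in> X"
  shows "card (walks X R (Suc k) x y) = (\<Sum>z\<in>X. card (walks X R k x z) * of_bool (R z y))"
proof -
  have "card (walks X R (Suc k) x y) =
      (\<Sum>z\<in>{z\<in>X. R z y}. card ((\<lambda>c. c @ [y]) ` walks X R k x z))"
    unfolding walks_Suc[OF assms(2,3)]
  proof (rule card_UN_disjoint)
    show "\<forall>i\<in>{z\<in>X. R z y}. \<forall>j\<in>{z\<in>X. R z y}. i \<noteq> j \<longrightarrow>
        (\<lambda>c. c @ [y]) ` walks X R k x i \<inter> (\<lambda>c. c @ [y]) ` walks X R k x j = {}"
      by (auto simp: walks_def)
  qed (use assms(1) in \<open>simp_all add: finite_walks\<close>)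
  also have "\<dots> = (\<Sum>z\<in>{z\<in>X. R z y}. card (walks X R k x z))"
    by (intro sum.cong refl card_image) (auto simp: inj_on_def)
  also have "\<dots> = (\<Sum>z\<in>X. card (walks X R k x z) * of_bool (R z y))"
    using assms(1) by (simp add: sum.inter_filter of_bool_def if_distrib cong: if_cong)
  finally show ?thesis .
qed

lemma adjacency_mat_pow_entry:
  assumes f: "bij_betw f {..<n} X" and "i < n" "j < n"
  shows "(adjacency_mat f n R ^\<^sub>m k) $$ (i, j) = of_nat (card (walks X R k (f i) (f j)))"
  using assms(2,3)
proof (induction k arbitrary: j)
  case 0
  have "f i = f j \<longleftrightarrow> i = j"
    using f 0 by (auto simp: bij_betw_def inj_on_def)
  moreover have "walks X R 0 (f i) (f j) = (if f i = f j then {[]} else {})"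
    by (auto simp: walks_def)
  ultimately show ?case
    using 0 by (simp add: adjacency_mat_def)
next
  case (Suc k)
  let ?A = "adjacency_mat f n R"
  have A: "?A \<in> carrier_mat n n"
    by (simp add: adjacency_mat_def)
  have fX: "finite X" "f i \<in> X" "f j \<in> X"
    using f Suc.prems by (auto simp: bij_betw_def)
  have "(?A ^\<^sub>m Suc k) $$ (i, j) = (\<Sum>l<n. (?A ^\<^sub>m k) $$ (i, l) * ?A $$ (l, j))"
    using A Suc.prems by (simp add: scalar_prod_def atLeast0LessThan)
  also have "\<dots> = (\<Sum>l<n. of_nat (card (walks X R k (f i) (f l)) * of_bool (R (f l) (f j))))"
    using Suc by (intro sum.cong) (auto simp: adjacency_mat_def)
  also have "\<dots> = (\<Sum>z\<in>X. of_nat (card (walks X R k (f i) z) * of_bool (R z (f j))))"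
    using f by (rule sum.reindex_bij_betw)
  also have "\<dots> = of_nat (card (walks X R (Suc k) (f i) (f j)))"
    using fX by (simp add: card_walks_Suc)
  finally show ?case .
qed

lemma cyclic_walks_iff_successively:
  "c \<in> cyclic_walks X R \<longleftrightarrow> c \<noteq> [] \<and> set c \<subseteq> X \<and> successively R (last c # c)"
proof (cases "c = []")
  case False
  then obtain n where n: "length c = Suc n"
    by (cases c) auto
  have last: "last c = c ! n"
    using False n by (simp add: last_conv_nth)
  have "successively R (last c # c) \<longleftrightarrow> R (c ! n) (c ! 0) \<and> (\<forall>i<n. R (c ! i) (c ! Suc i))"
    by (simp add: successively_conv_nth n last All_less_Suc2)
  also have "\<dots> \<longleftrightarrow> (\<forall>i<length c. R (c ! i) (c ! (Suc i mod length c)))"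
    unfolding n All_less_Suc by auto
  finally show ?thesis
    by (simp add: cyclic_walks_def)
qed (simp add: cyclic_walks_def)

lemma card_cyclic_walks_eq_trace:
  assumes f: "bij_betw f {..<n} X" and k: "k \<ge> 1"
  shows "complex_of_nat (card {c \<in> cyclic_walks X R. length c = k}) = trace_mat (adjacency_mat f n R ^\<^sub>m k)"
proof -
  have "finite X"
    using f by (simp add: bij_betw_finite[symmetric])
  have "{c \<in> cyclic_walks X R. length c = k} = (\<Union>x\<in>X. walks X R k x x)"
  proof (intro equalityI subsetI)
    fix c assume "c \<in> {c \<in> cyclic_walks X R. length c = k}"
    then have "c \<noteq> []" "c \<in> walks X R k (last c) (last c)" "last c \<in> X"
      by (auto simp: cyclic_walks_iff_successively walks_def)
    then show "c \<in> (\<Union>x\<in>X. walks X R k x x)"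
      by blast
  next
    fix c assume "c \<in> (\<Union>x\<in>X. walks X R k x x)"
    then obtain x where "length c = k" "set c \<subseteq> X" "successively R (x # c)" "last (x # c) = x"
      by (auto simp: walks_def simp del: last.simps)
    moreover from this have "c \<noteq> []"
      using k by auto
    ultimately show "c \<in> {c \<in> cyclic_walks X R. length c = k}"
      by (simp add: cyclic_walks_iff_successively)
  qed
  also have "card \<dots> = (\<Sum>x\<in>X. card (walks X R k x x))"
  proof (rule card_UN_disjoint)
    show "\<forall>x\<in>X. \<forall>y\<in>X. x \<noteq> y \<longrightarrow> walks X R k x x \<inter> walks X R k y y = {}"
      using k by (auto simp: walks_def split: if_splits)
  qed (use \<open>finite X\<close> in \<open>simp_all add: finite_walks\<close>)
  also have "complex_of_nat \<dots> = (\<Sum>i<n. of_nat (card (walks X R k (f i) (f i))))"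
    using sum.reindex_bij_betw[OF f, of "\<lambda>x. of_nat (card (walks X R k x x)) :: complex"] by simp
  also have "\<dots> = trace_mat (adjacency_mat f n R ^\<^sub>m k)"
    using adjacency_mat_pow_entry[OF f] by (simp add: trace_mat_def adjacency_mat_def)
  finally show ?thesis .
qed

section \<open>The Euler product\<close>

text \<open>
  The term at \<open>k = 0\<close> vanishes because division by zero is zero, so the sum may start at \<open>0\<close> or \<open>1\<close>.
\<close>
lemma has_sum_neg_Ln:
  fixes z :: complex
  assumes "norm z < 1"
  shows "((\<lambda>k. z ^ k / of_nat k) has_sum (- Ln (1 - z))) {1..}"
proof -
  have sums: "(\<lambda>k. z ^ k / of_nat k) sums (- Ln (1 - z))"
    using sums_minus[OF Ln_series'[of "- z"]] assms by simp
  have "summable (\<lambda>k. norm (z ^ k / of_nat k))"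
  proof (rule summable_comparison_test')
    show "summable (\<lambda>k. norm z ^ k)"
      using assms by (intro summable_geometric) simp
    show "norm (norm (z ^ k / of_nat k)) \<le> norm z ^ k" for k
      by (cases "k = 0") (auto simp: norm_divide norm_power divide_le_eq mult_le_cancel_left1)
  qed
  then have "((\<lambda>k. z ^ k / of_nat k) has_sum (- Ln (1 - z))) UNIV"
    using sums by (rule norm_summable_imp_has_sum)
  then show ?thesis
    by (rule has_sum_cong_neutral[THEN iffD1, rotated 3]) (auto simp: not_le)
qed

text \<open>
  There are at most \<open>(card X)\<^sup>k\<close> cyclic walks of length \<open>k\<close>, so a geometric series is a majorant.
\<close>
lemma summable_on_cyclic_walks:
  fixes u :: complex
  assumes X: "finite X" and u: "of_nat (card X) * norm u < 1"
  shows "(\<lambda>c. u ^ length c / of_nat (length c)) summable_on cyclic_walks X R"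
proof -
  let ?L = "\<lambda>k. {c. set c \<subseteq> X \<and> length c = k}"
  have "(\<lambda>(k, c). norm u ^ length c) summable_on Sigma UNIV ?L"
  proof (rule summable_on_SigmaI)
    fix k :: nat
    have "((\<lambda>c. norm u ^ length c) has_sum (\<Sum>c\<in>?L k. norm u ^ length c)) (?L k)"
      using X by (intro has_sum_finite finite_lists_length_eq)
    also have "(\<Sum>c\<in>?L k. norm u ^ length c) = (of_nat (card X) * norm u) ^ k"
      by (simp add: card_lists_length_eq[OF X] power_mult_distrib)
    finally show "((\<lambda>c. case (k, c) of (k, c) \<Rightarrow> norm u ^ length c) has_sum
        (of_nat (card X) * norm u) ^ k) (?L k)"
      by simp
  next
    show "(\<lambda>k. (of_nat (card X) * norm u) ^ k) summable_on UNIV"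
      using u by (intro norm_summable_imp_summable_on) (simp add: norm_power norm_mult)
  qed auto
  also have "(\<lambda>(k, c). norm u ^ length c) = (\<lambda>c. norm u ^ length c) \<circ> snd"
    by auto
  finally have "(\<lambda>c. norm u ^ length c) summable_on snd ` Sigma UNIV ?L"
    by (rule summable_on_reindex[THEN iffD2, rotated]) (auto simp: inj_on_def)
  then have "(\<lambda>c. norm u ^ length c) summable_on cyclic_walks X R"
    by (rule summable_on_subset_banach) (auto simp: cyclic_walks_def image_iff)
  then have "(\<lambda>c. norm (u ^ length c)) summable_on cyclic_walks X R"
    by (simp add: norm_power)
  then have "(\<lambda>c. norm (u ^ length c / of_nat (length c))) summable_on cyclic_walks X R"
    by (rule Infinite_Sum.abs_summable_on_comparison_test)
      (auto simp: norm_divide norm_power divide_le_eq mult_le_cancel_left1 cyclic_walks_def Suc_le_eq)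
  then show ?thesis
    by (rule abs_summable_summable)
qed

text \<open>
  The first of the two evaluations of the sum of \<open>u\<^bsup>length c\<^esup> / length c\<close> over all cyclic walks.
\<close>
lemma has_sum_by_length:
  fixes u :: complex
  assumes X: "finite X" and sum: "((\<lambda>c. u ^ length c / of_nat (length c)) has_sum s) (cyclic_walks X R)"
  shows "((\<lambda>k. of_nat (card {c \<in> cyclic_walks X R. length c = k}) * u ^ k / of_nat k) has_sum s) {1..}"
proof -
  let ?C = "\<lambda>k. {c \<in> cyclic_walks X R. length c = k}"
  have "bij_betw snd (Sigma {1..} ?C) (cyclic_walks X R)"
    by (rule bij_betwI[where g = "\<lambda>c. (length c, c)"]) (auto simp: cyclic_walks_def Suc_le_eq)
  then have "((\<lambda>p. u ^ length (snd p) / of_nat (length (snd p))) has_sum s) (Sigma {1..} ?C)"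
    using sum by (subst has_sum_reindex_bij_betw)
  then show ?thesis
  proof (rule has_sum_SigmaD)
    fix k :: nat
    have "finite (?C k)"
      by (rule finite_subset[OF _ finite_lists_length_eq[OF X, of k]]) (auto simp: cyclic_walks_def)
    then have "((\<lambda>c. u ^ length c / of_nat (length c)) has_sum
        (\<Sum>c\<in>?C k. u ^ length c / of_nat (length c))) (?C k)"
      by (rule has_sum_finite)
    then show "((\<lambda>c. u ^ length (snd (k, c)) / of_nat (length (snd (k, c)))) has_sum
        of_nat (card (?C k)) * u ^ k / of_nat k) (?C k)"
      by simp
  qed
qed

text \<open>
  The second evaluation. For a prime of length \<open>l\<close> the cyclic walks that are \<open>m\<close>-th powers of its \<open>l\<close>
  representatives contribute \<open>l u\<^bsup>m l\<^esup> / (m l)\<close>, and the sum over \<open>m\<close> is the logarithm of the Euler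
  factor.
\<close>
lemma has_sum_by_prime_class:
  fixes u :: complex and X :: "('v \<times> 'e) set"
  assumes u: "norm u < 1"
    and sum: "((\<lambda>c. u ^ length c / of_nat (length c)) has_sum s) (cyclic_walks X R)"
  shows "((\<lambda>P. - Ln (1 - u ^ prime_length P)) has_sum s) (prime_classes X R)"
proof -
  have "((\<lambda>x. u ^ (snd (fst x) * length (snd x)) / of_nat (snd (fst x) * length (snd x))) has_sum s)
      (Sigma (prime_classes X R \<times> {1..}) fst)"
    using has_sum_reindex_bij_betw[OF bij_betw_prime_powers[of X R],
        where f = "\<lambda>c. u ^ length c / of_nat (length c)" and S = s] sum
    by (simp only: case_prod_beta length_concat_replicate)
  then have "((\<lambda>x. (u ^ prime_length (fst x)) ^ snd x / of_nat (snd x)) has_sum s)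
      (prime_classes X R \<times> {1..})"
  proof (rule has_sum_SigmaD)
    fix x assume "x \<in> prime_classes X R \<times> {1 :: nat..}"
    then obtain P m where x: "x = (P, m)" and P: "P \<in> prime_classes X R"
      by auto
    obtain b where b: "b \<in> P"
      using prime_class_nonempty[OF P] by blast
    have fin: "finite P" and card: "card P = prime_length P"
      using card_prime_class[OF P b] prime_length_eq[OF P b] by simp_all
    have "((\<lambda>b. u ^ (m * length b) / of_nat (m * length b)) has_sum
        (\<Sum>b\<in>P. u ^ (m * length b) / of_nat (m * length b))) P"
      using fin by (rule has_sum_finite)
    also have "(\<Sum>b\<in>P. u ^ (m * length b) / of_nat (m * length b)) =
        (\<Sum>b\<in>P. u ^ (m * prime_length P) / of_nat (m * prime_length P))"
      by (intro sum.cong) (simp_all add: prime_length_eq[OF P])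
    also have "\<dots> = (u ^ prime_length P) ^ m / of_nat m"
      using prime_length_pos[OF P] by (simp add: card mult.commute flip: power_mult)
    finally show "((\<lambda>y. u ^ (snd (fst (x, y)) * length (snd (x, y))) /
        of_nat (snd (fst (x, y)) * length (snd (x, y)))) has_sum
        ((u ^ prime_length (fst x)) ^ snd x / of_nat (snd x))) (fst x)"
      by (simp only: x fst_conv snd_conv)
  qed
  then show ?thesis
  proof (rule has_sum_SigmaD)
    fix P assume "P \<in> prime_classes X R"
    then have "norm (u ^ prime_length P) < 1"
      using u prime_length_pos by (simp add: norm_power power_less_one_iff)
    from has_sum_neg_Ln[OF this]
    show "((\<lambda>m. (u ^ prime_length (fst (P, m))) ^ snd (P, m) / of_nat (snd (P, m))) has_sum
        - Ln (1 - u ^ prime_length P)) {1..}"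
      by (simp only: fst_conv snd_conv)
  qed
qed

lemma has_sum_sum:
  fixes f :: "'i \<Rightarrow> 'a \<Rightarrow> 'b :: topological_comm_monoid_add"
  assumes "finite I" "\<And>i. i \<in> I \<Longrightarrow> (f i has_sum s i) A"
  shows "((\<lambda>x. \<Sum>i\<in>I. f i x) has_sum (\<Sum>i\<in>I. s i)) A"
  using assms by (induction I rule: finite_induct) (auto intro!: has_sum_add)

text \<open>
  The sum over cyclic walks is the logarithm of the Euler product when grouped by primes. Grouped by
  length it is the sum of \<open>trace (A\<^sup>k) u\<^sup>k / k\<close>, that is, of the logarithms of \<open>1 / (1 - b u)\<close> over the
  eigenvalues \<open>b\<close> of the adjacency matrix \<open>A\<close>, which is the logarithm of \<open>1 / det (1 - u A)\<close>.
\<close>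
theorem euler_product_eq_inverse_det:
  fixes X :: "('v \<times> 'e) set"
  assumes f: "bij_betw f {..<n} X"
  shows "\<exists>Z \<epsilon>. \<epsilon> > 0 \<and> (\<forall>u. poly Z u = det (1\<^sub>m n - u \<cdot>\<^sub>m adjacency_mat f n R)) \<and>
    (\<forall>u. norm u < \<epsilon> \<longrightarrow> poly Z u \<noteq> 0 \<and>
       ((\<lambda>F. \<Prod>P\<in>F. inverse (1 - u ^ prime_length P)) \<longlongrightarrow> inverse (poly Z u))
         (finite_subsets_at_top (prime_classes X R)))"
proof -
  let ?A = "adjacency_mat f n R"
  have "finite X"
    using f by (simp add: bij_betw_finite[symmetric])
  have "?A \<in> carrier_mat n n"
    by (simp add: adjacency_mat_def)
  then obtain b where trace: "\<And>k. trace_mat (?A ^\<^sub>m k) = (\<Sum>i<n. b i ^ k)"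
    and det: "\<And>u. det (1\<^sub>m n - u \<cdot>\<^sub>m ?A) = (\<Prod>i<n. 1 - b i * u)"
    using eigenvalues_trace_det by blast
  define Z where "Z = (\<Prod>i<n. [:1, - b i:])"
  have Z: "poly Z u = (\<Prod>i<n. 1 - b i * u)" for u
    by (simp add: Z_def poly_prod mult.commute)
  \<comment> \<open>For \<open>norm u < 1 / M\<close> all three series converge: over the walks, over the powers of an eigenvalue and over the powers of a prime.\<close>
  define M where "M = 1 + of_nat (card X) + (\<Sum>i<n. norm (b i))"
  have M: "1 \<le> M" "of_nat (card X) \<le> M" "\<And>i. i < n \<Longrightarrow> norm (b i) \<le> M"
  proof -
    have nonneg: "0 \<le> (\<Sum>i<n. norm (b i))"
      by (intro sum_nonneg) simp
    then show "1 \<le> M" "of_nat (card X) \<le> M"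
      by (simp_all add: M_def)
    fix i assume "i < n"
    then have "norm (b i) \<le> (\<Sum>i<n. norm (b i))"
      by (intro member_le_sum) auto
    then show "norm (b i) \<le> M"
      by (simp add: M_def)
  qed
  have "poly Z u \<noteq> 0 \<and>
      ((\<lambda>F. \<Prod>P\<in>F. inverse (1 - u ^ prime_length P)) \<longlongrightarrow> inverse (poly Z u))
        (finite_subsets_at_top (prime_classes X R))" if u: "norm u < 1 / M" for u
  proof -
    have small: "a * norm u < 1" if "0 \<le> a" "a \<le> M" for a
    proof -
      have "a * norm u \<le> M * norm u"
        using that by (intro mult_right_mono) auto
      also have "\<dots> < 1"
        using u M(1) by (simp add: field_simps)
      finally show ?thesis .
    qed
    have u1: "norm u < 1"
      using small[of 1] M(1) by simp
    have bu: "norm (b i * u) < 1" if "i < n" for i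
      using small[of "norm (b i)"] M(3)[OF that] by (simp add: norm_mult)
    then have nz: "1 - b i * u \<noteq> 0" if "i < n" for i
      using that by fastforce
    obtain s where s: "((\<lambda>c. u ^ length c / of_nat (length c)) has_sum s) (cyclic_walks X R)"
      using summable_on_cyclic_walks[OF \<open>finite X\<close>, of u R] small[of "of_nat (card X)"] M(2)
      by (auto simp: summable_on_def)
    have "((\<lambda>k. \<Sum>i<n. (b i * u) ^ k / of_nat k) has_sum (\<Sum>i<n. - Ln (1 - b i * u))) {1..}"
      using bu by (intro has_sum_sum has_sum_neg_Ln) auto
    also have "?this \<longleftrightarrow> ((\<lambda>k. of_nat (card {c \<in> cyclic_walks X R. length c = k}) * u ^ k / of_nat k)
        has_sum (\<Sum>i<n. - Ln (1 - b i * u))) {1..}"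
      by (intro has_sum_cong)
        (simp add: card_cyclic_walks_eq_trace[OF f] trace sum_distrib_right power_mult_distrib
          flip: sum_divide_distrib)
    finally have s_eq: "s = (\<Sum>i<n. - Ln (1 - b i * u))"
      using has_sum_by_length[OF \<open>finite X\<close> s] has_sum_unique by blast
    have exp_s: "exp s = inverse (poly Z u)"
      using nz by (simp add: s_eq Z exp_sum exp_minus prod_inversef[symmetric])
    have "((\<lambda>F. exp (\<Sum>P\<in>F. - Ln (1 - u ^ prime_length P))) \<longlongrightarrow> exp s)
        (finite_subsets_at_top (prime_classes X R))"
      using has_sum_by_prime_class[OF u1 s] unfolding has_sum_def by (rule tendsto_exp)
    moreover have "\<forall>\<^sub>F F in finite_subsets_at_top (prime_classes X R).
        exp (\<Sum>P\<in>F. - Ln (1 - u ^ prime_length P)) = (\<Prod>P\<in>F. inverse (1 - u ^ prime_length P))"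
    proof (rule eventually_finite_subsets_at_top_weakI)
      fix F assume F: "finite F" "F \<subseteq> prime_classes X R"
      have "1 - u ^ prime_length P \<noteq> 0" if P: "P \<in> F" for P
      proof -
        have "prime_length P > 0"
          using P F(2) prime_length_pos by blast
        then have "norm (u ^ prime_length P) < 1"
          using u1 by (simp add: norm_power power_less_one_iff)
        then show ?thesis
          by auto
      qed
      then show "exp (\<Sum>P\<in>F. - Ln (1 - u ^ prime_length P)) = (\<Prod>P\<in>F. inverse (1 - u ^ prime_length P))"
        using F by (simp add: exp_sum exp_minus cong: prod.cong)
    qed
    ultimately have "((\<lambda>F. \<Prod>P\<in>F. inverse (1 - u ^ prime_length P)) \<longlongrightarrow> inverse (poly Z u))
        (finite_subsets_at_top (prime_classes X R))"
      unfolding exp_s by (rule Lim_transform_eventually)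
    then show ?thesis
      using nz by (simp add: Z)
  qed
  moreover have "1 / M > 0"
    using M(1) by simp
  ultimately show ?thesis
    using det Z by (intro exI[of _ Z] exI[of _ "1 / M"]) simp
qed

section \<open>Primes of a hypergraph as primes of a directed graph\<close>

definition flags :: "('v, 'e) hypergraph \<Rightarrow> ('v \<times> 'e) set" where
  "flags H = {(v, e). v \<in> hypervertices H \<and> e \<in> hyperedges H \<and> v \<in> members H e}"

text \<open>
  The conditions on consecutive pairs of a closed path without backtracking. That the second vertex
  lies in its own hyperedge is part of the second pair being a flag.
\<close>
definition flag_step :: "('v, 'e) hypergraph \<Rightarrow> 'v \<times> 'e \<Rightarrow> 'v \<times> 'e \<Rightarrow> bool" where
  "flag_step H x y \<longleftrightarrow> fst x \<noteq> fst y \<and> fst y \<in> members H (snd x) \<and> snd x \<noteq> snd y"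

text \<open>
  The two conditions on hyperedge backtracking together say that cyclically consecutive hyperedges
  are distinct: the square of \<open>c\<close> shows all cyclically consecutive pairs of \<open>c\<close>, including the last
  with the first.
\<close>
lemma cyclic_walks_flags_iff:
  "c \<in> cyclic_walks (flags H) (flag_step H) \<longleftrightarrow>
     closed_path H c \<and> \<not> hyperedge_backtracking c \<and> tail_less c"
proof (cases "c = []")
  case False
  let ?n = "length c"
  have closed: "closed_path H c \<longleftrightarrow> (\<forall>i<?n. c ! i \<in> flags H \<and>
      fst (c ! (Suc i mod ?n)) \<in> members H (snd (c ! i)) \<and> fst (c ! i) \<noteq> fst (c ! (Suc i mod ?n)))"
    using False by (auto simp: closed_path_def flags_def Let_def case_prod_beta)
  have tail: "tail_less c \<longleftrightarrow> (\<forall>i<?n. snd (c ! i) \<noteq> snd (c ! (Suc i mod ?n)))"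
  proof -
    have nth: "path_power c 2 ! i = c ! (i mod ?n)" if "i < 2 * ?n" for i
      using that by (simp add: path_power_def nth_concat_replicate)
    have len: "length (path_power c 2) = 2 * ?n"
      by (simp add: path_power_def length_concat_replicate)
    have "tail_less c \<longleftrightarrow> (\<forall>i. Suc i < 2 * ?n \<longrightarrow> snd (c ! (i mod ?n)) \<noteq> snd (c ! (Suc i mod ?n)))"
      by (auto simp: tail_less_def hyperedge_backtracking_def len nth)
    also have "\<dots> \<longleftrightarrow> (\<forall>i<?n. snd (c ! i) \<noteq> snd (c ! (Suc i mod ?n)))"
    proof (intro iffI allI impI)
      fix i assume *: "\<forall>i. Suc i < 2 * ?n \<longrightarrow> snd (c ! (i mod ?n)) \<noteq> snd (c ! (Suc i mod ?n))"
        and "i < ?n"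
      then have "Suc i < 2 * ?n \<or> i = 0 \<and> ?n = 1"
        by linarith
      with *[rule_format, of i] *[rule_format, of 0] \<open>i < ?n\<close>
      show "snd (c ! i) \<noteq> snd (c ! (Suc i mod ?n))"
        by auto
    next
      fix i assume *: "\<forall>i<?n. snd (c ! i) \<noteq> snd (c ! (Suc i mod ?n))" and "Suc i < 2 * ?n"
      have "i mod ?n < ?n"
        using False by simp
      with * have "snd (c ! (i mod ?n)) \<noteq> snd (c ! (Suc (i mod ?n) mod ?n))"
        by blast
      then show "snd (c ! (i mod ?n)) \<noteq> snd (c ! (Suc i mod ?n))"
        by (simp add: mod_Suc_eq)
    qed
    finally show ?thesis .
  qed
  have backtrack: "\<not> hyperedge_backtracking c" if "\<forall>i<?n. snd (c ! i) \<noteq> snd (c ! (Suc i mod ?n))"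
    unfolding hyperedge_backtracking_def
  proof (intro notI, elim exE conjE)
    fix i assume i: "Suc i < ?n" and "snd (c ! i) = snd (c ! Suc i)"
    with that[rule_format, of i] show False
      by simp
  qed
  have sub: "set c \<subseteq> flags H \<longleftrightarrow> (\<forall>i<?n. c ! i \<in> flags H)"
    by (auto simp: set_conv_nth)
  show ?thesis
    unfolding cyclic_walks_def mem_Collect_eq sub flag_step_def closed tail
    using False backtrack unfolding tail by blast
qed (simp add: cyclic_walks_def closed_path_def)

text \<open>
  Restricting the bases of proper powers to closed paths makes no difference, since the base of a
  cyclic walk is a cyclic walk.
\<close>
lemma prime_cycles_eq_prime_classes:
  "prime_cycles H = prime_classes (flags H) (flag_step H)"
proof -
  have "primitive_cycle H c \<longleftrightarrow> c \<in> cyclic_walks (flags H) (flag_step H) \<and> primitive_word c" for c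
  proof (cases "c \<in> cyclic_walks (flags H) (flag_step H)")
    case True
    then have "c \<noteq> []"
      by (simp add: cyclic_walks_def)
    have "closed_path H b" if "c = concat (replicate m b)" "m \<ge> 2" for b m
    proof -
      have "b \<in> cyclic_walks (flags H) (flag_step H)"
        using True that cyclic_walks_power_iff[of m b "flags H" "flag_step H"] by simp
      then show ?thesis
        by (simp add: cyclic_walks_flags_iff)
    qed
    then have "primitive_word c \<longleftrightarrow> \<not> (\<exists>b m. m \<ge> 2 \<and> closed_path H b \<and> c = path_power b m)"
      unfolding primitive_word_def path_power_def using \<open>c \<noteq> []\<close> by (auto simp flip: not_less)
    then show ?thesis
      using True by (simp add: primitive_cycle_def cyclic_walks_flags_iff)
  qed (auto simp: primitive_cycle_def cyclic_walks_flags_iff)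
  then show ?thesis
    by (simp add: prime_cycles_def prime_classes_def rotation_rel_def conj_commute)
qed

text \<open>
  Two polynomials with this property agree on a ball, hence everywhere.
\<close>
lemma zeta_inv_poly_eq:
  assumes "\<epsilon> > 0" and
    Z: "\<And>u. norm u < \<epsilon> \<Longrightarrow> poly Z u \<noteq> 0 \<and> has_euler_product H u (inverse (poly Z u))"
  shows "zeta_inv_poly H = Z"
  unfolding zeta_inv_poly_def
proof (rule the_equality)
  show "\<exists>\<epsilon>>0. \<forall>u. norm u < \<epsilon> \<longrightarrow> poly Z u \<noteq> 0 \<and> has_euler_product H u (inverse (poly Z u))"
    using assms by blast
next
  fix Y
  assume "\<exists>\<epsilon>>0. \<forall>u. norm u < \<epsilon> \<longrightarrow> poly Y u \<noteq> 0 \<and> has_euler_product H u (inverse (poly Y u))"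
  then obtain \<delta> where \<delta>: "\<delta> > 0"
    and Y: "\<And>u. norm u < \<delta> \<Longrightarrow> poly Y u \<noteq> 0 \<and> has_euler_product H u (inverse (poly Y u))"
    by blast
  have "poly (Y - Z) u = 0" if "u \<in> ball 0 (min \<epsilon> \<delta>)" for u
  proof -
    have "norm u < \<epsilon>" "norm u < \<delta>"
      using that by auto
    then have "inverse (poly Y u) = inverse (poly Z u)"
      using Y[of u] Z[of u] tendsto_unique[OF finite_subsets_at_top_neq_bot]
      unfolding has_euler_product_def by blast
    then show ?thesis
      by simp
  qed
  then have "ball 0 (min \<epsilon> \<delta>) \<subseteq> {u. poly (Y - Z) u = 0}"
    by blast
  moreover have "infinite (ball (0 :: complex) (min \<epsilon> \<delta>))"
    using assms(1) \<delta> by (intro uncountable_infinite uncountable_ball) simp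
  ultimately have "Y - Z = 0"
    using poly_roots_finite[of "Y - Z"] finite_subset by blast
  then show "Y = Z"
    by simp
qed

section \<open>The determinant formula for the zeta function\<close>

text \<open>
  Elements \<open>f i\<close> against the classes \<open>g j\<close> to which \<open>\<pi>\<close> maps them; used with \<open>\<pi>\<close> the projection of a flag
  to its hypervertex or to its hyperedge.
\<close>
definition incidence_mat :: "(nat \<Rightarrow> 'a) \<Rightarrow> nat \<Rightarrow> ('a \<Rightarrow> 'b) \<Rightarrow> (nat \<Rightarrow> 'b) \<Rightarrow> nat \<Rightarrow> complex mat" where
  "incidence_mat f N \<pi> g m = mat N m (\<lambda>(i, j). of_bool (\<pi> (f i) = g j))"

lemma incidence_mat_carrier: "incidence_mat f N \<pi> g m \<in> carrier_mat N m"
  by (simp add: incidence_mat_def)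

lemma sum_of_bool_eq_card: "finite A \<Longrightarrow> (\<Sum>x\<in>A. of_bool (P x)) = (of_nat (card {x \<in> A. P x}) :: complex)"
  by (simp add: of_bool_def sum.If_cases Int_def)

lemma incidence_mult_transpose_entry:
  assumes g: "bij_betw g {..<m} Y" and "\<And>i. i < N \<Longrightarrow> \<pi> (f i) \<in> Y" and "i < N" "j < N"
  shows "(incidence_mat f N \<pi> g m * transpose_mat (incidence_mat f N \<pi> g m)) $$ (i, j) =
    of_bool (\<pi> (f i) = \<pi> (f j))"
proof -
  have Y: "finite Y" "\<pi> (f i) \<in> Y"
    using assms by (auto simp: bij_betw_def)
  have "(incidence_mat f N \<pi> g m * transpose_mat (incidence_mat f N \<pi> g m)) $$ (i, j) =
      (\<Sum>l<m. of_bool (\<pi> (f i) = g l) * of_bool (\<pi> (f j) = g l))"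
    using assms(3,4) by (simp add: incidence_mat_def scalar_prod_def atLeast0LessThan)
  also have "\<dots> = (\<Sum>y\<in>Y. of_bool (\<pi> (f i) = y) * of_bool (\<pi> (f j) = y))"
    using g by (rule sum.reindex_bij_betw)
  also have "\<dots> = (\<Sum>y\<in>Y. if y = \<pi> (f i) then of_bool (\<pi> (f i) = \<pi> (f j)) else 0)"
    by (intro sum.cong) auto
  also have "\<dots> = of_bool (\<pi> (f i) = \<pi> (f j))"
    using Y by simp
  finally show ?thesis .
qed

lemma transpose_mult_incidence:
  assumes f: "bij_betw f {..<N} X" and g: "bij_betw g {..<m} Y"
    and card: "\<And>y. y \<in> Y \<Longrightarrow> card {x \<in> X. \<pi> x = y} = d"
  shows "transpose_mat (incidence_mat f N \<pi> g m) * incidence_mat f N \<pi> g m = of_nat d \<cdot>\<^sub>m 1\<^sub>m m"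
proof (rule eq_matI)
  fix i j assume "i < dim_row (of_nat d \<cdot>\<^sub>m 1\<^sub>m m :: complex mat)" "j < dim_col (of_nat d \<cdot>\<^sub>m 1\<^sub>m m :: complex mat)"
  then have ij: "i < m" "j < m"
    by auto
  have "finite X"
    using f by (auto simp: bij_betw_def)
  have eq: "g i = g j \<longleftrightarrow> i = j" "g i \<in> Y"
    using g ij by (auto simp: bij_betw_def inj_on_def)
  have "(transpose_mat (incidence_mat f N \<pi> g m) * incidence_mat f N \<pi> g m) $$ (i, j) =
      (\<Sum>k<N. of_bool (\<pi> (f k) = g i) * of_bool (\<pi> (f k) = g j))"
    using ij by (simp add: incidence_mat_def scalar_prod_def atLeast0LessThan)
  also have "\<dots> = (\<Sum>k<N. of_bool (\<pi> (f k) = g i \<and> \<pi> (f k) = g j))"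
    by (simp only: of_bool_conj)
  also have "\<dots> = (\<Sum>x\<in>X. of_bool (\<pi> x = g i \<and> \<pi> x = g j))"
    using f by (rule sum.reindex_bij_betw)
  also have "\<dots> = of_nat (card {x \<in> X. \<pi> x = g i \<and> \<pi> x = g j})"
    using \<open>finite X\<close> by (rule sum_of_bool_eq_card)
  also have "{x \<in> X. \<pi> x = g i \<and> \<pi> x = g j} = (if i = j then {x \<in> X. \<pi> x = g i} else {})"
    using eq by auto
  also have "of_nat (card \<dots>) = (of_nat d \<cdot>\<^sub>m 1\<^sub>m m :: complex mat) $$ (i, j)"
    using ij card[OF eq(2)] by (cases "i = j") auto
  finally show "(transpose_mat (incidence_mat f N \<pi> g m) * incidence_mat f N \<pi> g m) $$ (i, j) =
      (of_nat d \<cdot>\<^sub>m 1\<^sub>m m) $$ (i, j)" .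
qed (simp_all add: incidence_mat_def)

lemma mat_mult_entry:
  assumes "A \<in> carrier_mat m n" "B \<in> carrier_mat n k" "i < m" "j < k"
  shows "(A * B) $$ (i, j) = (\<Sum>l<n. A $$ (i, l) * B $$ (l, j))"
  using assms by (simp add: scalar_prod_def atLeast0LessThan)

text \<open>
  The relation is the composition of two moves: to a different flag with the same hyperedge, whose
  matrix is \<open>C C\<^sup>T - 1\<close>, and then to a different flag with the same hypervertex, whose matrix is
  \<open>S S\<^sup>T - 1\<close>. The intermediate flag \<open>(v', e)\<close> is determined by the end points, so the product has
  entries \<open>0\<close> and \<open>1\<close>.
\<close>
lemma adjacency_flag_step_entry:
  fixes H :: "('v, 'e) hypergraph"
  assumes f: "bij_betw f {..<N} (flags H)" and gv: "bij_betw gv {..<n\<^sub>1} (hypervertices H)"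
    and ge: "bij_betw ge {..<n\<^sub>2} (hyperedges H)" and ij: "i < N" "j < N"
  defines "C \<equiv> incidence_mat f N snd ge n\<^sub>2" and "S \<equiv> incidence_mat f N fst gv n\<^sub>1"
  shows "adjacency_mat f N (flag_step H) $$ (i, j) =
      (C * transpose_mat C * (S * transpose_mat S)) $$ (i, j) - (C * transpose_mat C) $$ (i, j)
      - (S * transpose_mat S) $$ (i, j) + (if i = j then 1 else 0)"
proof -
  have flag: "f k \<in> flags H" if "k < N" for k
    using f that by (auto simp: bij_betw_def)
  have fin: "finite (flags H)"
    using bij_betw_finite[OF f] by simp
  have P: "(C * transpose_mat C) $$ (k, l) = of_bool (snd (f k) = snd (f l))" if "k < N" "l < N" for k l
    unfolding C_def using flag that
    by (intro incidence_mult_transpose_entry[OF ge]) (auto simp: flags_def case_prod_beta)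
  have R: "(S * transpose_mat S) $$ (k, l) = of_bool (fst (f k) = fst (f l))" if "k < N" "l < N" for k l
    unfolding S_def using flag that
    by (intro incidence_mult_transpose_entry[OF gv]) (auto simp: flags_def case_prod_beta)
  have carrier: "C * transpose_mat C \<in> carrier_mat N N" "S * transpose_mat S \<in> carrier_mat N N"
    unfolding C_def S_def by (auto simp: incidence_mat_def)
  have "(C * transpose_mat C * (S * transpose_mat S)) $$ (i, j) =
      (\<Sum>k<N. (C * transpose_mat C) $$ (i, k) * (S * transpose_mat S) $$ (k, j))"
    using carrier ij by (rule mat_mult_entry)
  also have "\<dots> = (\<Sum>k<N. of_bool (snd (f i) = snd (f k) \<and> fst (f k) = fst (f j)))"
    using ij by (intro sum.cong) (simp_all add: P R)
  also have "\<dots> = (\<Sum>x\<in>flags H. of_bool (snd (f i) = snd x \<and> fst x = fst (f j)))"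
    using f by (rule sum.reindex_bij_betw)
  also have "\<dots> = of_nat (card {x \<in> flags H. snd (f i) = snd x \<and> fst x = fst (f j)})"
    using fin by (rule sum_of_bool_eq_card)
  also have "{x \<in> flags H. snd (f i) = snd x \<and> fst x = fst (f j)} =
      (if (fst (f j), snd (f i)) \<in> flags H then {(fst (f j), snd (f i))} else {})"
    by auto
  also have "(fst (f j), snd (f i)) \<in> flags H \<longleftrightarrow> fst (f j) \<in> members H (snd (f i))"
    using flag[OF ij(1)] flag[OF ij(2)] by (auto simp: flags_def)
  finally have PR: "(C * transpose_mat C * (S * transpose_mat S)) $$ (i, j) =
      of_bool (fst (f j) \<in> members H (snd (f i)))"
    by simp
  have inj: "i = j \<longleftrightarrow> fst (f i) = fst (f j) \<and> snd (f i) = snd (f j)"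
    using f ij by (auto simp: bij_betw_def inj_on_def prod_eq_iff)
  have "fst (f i) \<in> members H (snd (f i))" "fst (f j) \<in> members H (snd (f j))"
    using flag[OF ij(1)] flag[OF ij(2)] by (auto simp: flags_def)
  then show ?thesis
    unfolding PR P[OF ij] R[OF ij] inj using ij
    by (auto simp: adjacency_mat_def flag_step_def)
qed

lemma card_bip_edges: "card (bip_edges H) = card (flags H)"
proof -
  have "bip_edges H = (\<lambda>(v, e). {Inl v, Inr e}) ` flags H"
    by (auto simp: bip_edges_def flags_def)
  moreover have "inj_on (\<lambda>(v, e). {Inl v, Inr e}) (flags H)"
    by (auto simp: inj_on_def doubleton_eq_iff)
  ultimately show ?thesis
    by (simp add: card_image)
qed

lemma euler_char_eq:
  assumes "finite_hypergraph H"
  shows "euler_char H =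
    int (card (hypervertices H) + card (hyperedges H)) - int (card (flags H))"
  using assms by (simp add: euler_char_def bip_vertices_def card_bip_edges finite_hypergraph_def card_Plus)

text \<open>
  Both parts are instances of the formula for \<open>det (1 - u T)\<close>, the second with hypervertices and
  hyperedges exchanged. Exchanging them reverses the order of the factors \<open>C C\<^sup>T - 1\<close> and
  \<open>S S\<^sup>T - 1\<close>, that is, it transposes \<open>T\<close>. Powers occur on both sides of the equations because the
  exponents of their quotients may have either sign.
\<close>
lemma zeta_inv_poly_determinant:
  fixes H :: "('v, 'e) hypergraph" and d r :: nat
  assumes H: "is_hypergraph H" "finite_hypergraph H" "regular_hypergraph d r H"
  defines "n\<^sub>1 \<equiv> card (hypervertices H)" and "n\<^sub>2 \<equiv> card (hyperedges H)" and "N \<equiv> card (flags H)"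
    and "\<alpha> \<equiv> \<lambda>u :: complex. 1 + (of_nat r - 1) * u" and "\<beta> \<equiv> \<lambda>u :: complex. 1 + (of_nat d - 1) * u"
  shows "\<exists>K\<in>carrier_mat n\<^sub>1 n\<^sub>1. \<forall>u. u \<noteq> 1 \<longrightarrow> \<alpha> u \<noteq> 0 \<longrightarrow>
      (1 - u) ^ (n\<^sub>1 + n\<^sub>2) * \<alpha> u ^ n\<^sub>1 * poly (zeta_inv_poly H) u =
      (1 - u) ^ N * \<alpha> u ^ n\<^sub>2 * det ((\<alpha> u * \<beta> u) \<cdot>\<^sub>m 1\<^sub>m n\<^sub>1 - u \<cdot>\<^sub>m K)" (is ?vertex)
    and "\<exists>K\<in>carrier_mat n\<^sub>2 n\<^sub>2. \<forall>u. u \<noteq> 1 \<longrightarrow> \<beta> u \<noteq> 0 \<longrightarrow>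
      (1 - u) ^ (n\<^sub>2 + n\<^sub>1) * \<beta> u ^ n\<^sub>2 * poly (zeta_inv_poly H) u =
      (1 - u) ^ N * \<beta> u ^ n\<^sub>1 * det ((\<beta> u * \<alpha> u) \<cdot>\<^sub>m 1\<^sub>m n\<^sub>2 - u \<cdot>\<^sub>m K)" (is ?edge)
proof -
  have fin: "finite (hypervertices H)" "finite (hyperedges H)"
    using H(2) by (auto simp: finite_hypergraph_def)
  then have "finite (flags H)"
    by (intro finite_subset[of "flags H" "hypervertices H \<times> hyperedges H"]) (auto simp: flags_def)
  then obtain f where f: "bij_betw f {..<N} (flags H)"
    unfolding N_def using ex_bij_betw_nat_finite[of "flags H"] by (auto simp: atLeast0LessThan)
  obtain gv where gv: "bij_betw gv {..<n\<^sub>1} (hypervertices H)"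
    unfolding n\<^sub>1_def using ex_bij_betw_nat_finite[OF fin(1)] by (auto simp: atLeast0LessThan)
  obtain ge where ge: "bij_betw ge {..<n\<^sub>2} (hyperedges H)"
    unfolding n\<^sub>2_def using ex_bij_betw_nat_finite[OF fin(2)] by (auto simp: atLeast0LessThan)
  define T where "T = adjacency_mat f N (flag_step H)"
  define C where "C = incidence_mat f N snd ge n\<^sub>2"
  define S where "S = incidence_mat f N fst gv n\<^sub>1"
  have T: "T \<in> carrier_mat N N"
    by (simp add: T_def adjacency_mat_def)
  have C: "C \<in> carrier_mat N n\<^sub>2" and S: "S \<in> carrier_mat N n\<^sub>1"
    by (simp_all add: C_def S_def incidence_mat_carrier)
  have zeta: "poly (zeta_inv_poly H) u = det (1\<^sub>m N - u \<cdot>\<^sub>m T)" for u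
  proof -
    obtain Z \<epsilon> where "\<epsilon> > 0" "\<And>u. poly Z u = det (1\<^sub>m N - u \<cdot>\<^sub>m T)"
      "\<And>u. norm u < \<epsilon> \<Longrightarrow> poly Z u \<noteq> 0 \<and> has_euler_product H u (inverse (poly Z u))"
      using euler_product_eq_inverse_det[OF f, of "flag_step H"]
      unfolding has_euler_product_def prime_cycles_eq_prime_classes T_def by blast
    then show ?thesis
      using zeta_inv_poly_eq[of \<epsilon> Z H] by simp
  qed
  have members: "members H e \<subseteq> hypervertices H" if "e \<in> hyperedges H" for e
    using H(1) that by (auto simp: is_hypergraph_def)
  have "card {x \<in> flags H. snd x = e} = r" if e: "e \<in> hyperedges H" for e
  proof -
    have "{x \<in> flags H. snd x = e} = (\<lambda>v. (v, e)) ` members H e"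
      using members[OF e] e by (auto simp: flags_def)
    then show ?thesis
      using H(3) e by (simp add: card_image inj_on_def regular_hypergraph_def)
  qed
  then have CC: "transpose_mat C * C = of_nat r \<cdot>\<^sub>m 1\<^sub>m n\<^sub>2"
    unfolding C_def by (rule transpose_mult_incidence[OF f ge])
  have "card {x \<in> flags H. fst x = v} = d" if v: "v \<in> hypervertices H" for v
  proof -
    have "{x \<in> flags H. fst x = v} = Pair v ` {e \<in> hyperedges H. v \<in> members H e}"
      using v by (auto simp: flags_def)
    then show ?thesis
      using H(3) v by (simp add: card_image inj_on_def regular_hypergraph_def)
  qed
  then have SS: "transpose_mat S * S = of_nat d \<cdot>\<^sub>m 1\<^sub>m n\<^sub>1"
    unfolding S_def by (rule transpose_mult_incidence[OF f gv])
  note entry = adjacency_flag_step_entry[OF f gv ge, folded T_def C_def S_def]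
  show ?vertex
  proof (intro bexI allI impI)
    fix u :: complex assume "u \<noteq> 1" "\<alpha> u \<noteq> 0"
    then show "(1 - u) ^ (n\<^sub>1 + n\<^sub>2) * \<alpha> u ^ n\<^sub>1 * poly (zeta_inv_poly H) u = (1 - u) ^ N * \<alpha> u ^ n\<^sub>2 *
        det ((\<alpha> u * \<beta> u) \<cdot>\<^sub>m 1\<^sub>m n\<^sub>1 - u \<cdot>\<^sub>m (transpose_mat S * (C * transpose_mat C) * S))"
      unfolding zeta \<alpha>_def \<beta>_def by (intro det_regular_incidence[OF C S T CC SS entry]) simp_all
  qed (intro carrier_matI; use S in simp)
  show ?edge
  proof (intro bexI allI impI)
    fix u :: complex assume u: "u \<noteq> 1" "\<beta> u \<noteq> 0"
    have T': "transpose_mat T \<in> carrier_mat N N"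
      using T by simp
    have entry': "transpose_mat T $$ (i, j) =
        (S * transpose_mat S * (C * transpose_mat C)) $$ (i, j) - (S * transpose_mat S) $$ (i, j)
        - (C * transpose_mat C) $$ (i, j) + (if i = j then 1 else 0)" if ij: "i < N" "j < N" for i j
    proof -
      have sym: "transpose_mat (A * transpose_mat A) = A * transpose_mat A" if "A \<in> carrier_mat N n"
        for A :: "complex mat" and n
        using that by (simp add: transpose_mult[of _ N n _ N])
      have carrier: "C * transpose_mat C \<in> carrier_mat N N" "S * transpose_mat S \<in> carrier_mat N N"
        using C S by simp_all
      have swap: "M $$ (j, i) = transpose_mat M $$ (i, j)" if "M \<in> carrier_mat N N" for M :: "complex mat"
        using that ij by simp
      have "transpose_mat (C * transpose_mat C * (S * transpose_mat S)) =
          S * transpose_mat S * (C * transpose_mat C)"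
        using transpose_mult[OF carrier] sym[OF C] sym[OF S] by (simp only:)
      then show ?thesis
        using entry[OF ij(2,1)] ij T swap[OF carrier(1)] swap[OF carrier(2)] sym[OF C] sym[OF S]
          swap[OF mult_carrier_mat[OF carrier]]
        by (simp add: eq_commute[of i j] del: index_mult_mat(1))
    qed
    have "det (1\<^sub>m N - u \<cdot>\<^sub>m T) = det (transpose_mat (1\<^sub>m N - u \<cdot>\<^sub>m T))"
      using T by (intro det_transpose[symmetric, of _ N]) (intro minus_carrier_mat, simp)
    also have "transpose_mat (1\<^sub>m N - u \<cdot>\<^sub>m T) = 1\<^sub>m N - u \<cdot>\<^sub>m transpose_mat T"
      using T by (intro eq_matI) auto
    finally have zeta': "poly (zeta_inv_poly H) u = det (1\<^sub>m N - u \<cdot>\<^sub>m transpose_mat T)"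
      by (simp only: zeta)
    show "(1 - u) ^ (n\<^sub>2 + n\<^sub>1) * \<beta> u ^ n\<^sub>2 * poly (zeta_inv_poly H) u = (1 - u) ^ N * \<beta> u ^ n\<^sub>1 *
        det ((\<beta> u * \<alpha> u) \<cdot>\<^sub>m 1\<^sub>m n\<^sub>2 - u \<cdot>\<^sub>m (transpose_mat C * (S * transpose_mat S) * C))"
      unfolding zeta' \<alpha>_def \<beta>_def
      using u by (intro det_regular_incidence[OF S C T' SS CC entry']) (simp_all add: \<beta>_def)
  qed (intro carrier_matI; use C in simp)
qed

section \<open>The functional equations\<close>

text \<open>
  Common form of both functional equations: the powers in \<open>L\<close> cancel those in \<open>Z\<close>, so that \<open>L\<close> is
  \<open>p\<^sup>n\<close> divided by the determinant, and numerator and denominator are both multiplied by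
  \<open>(q u\<^sup>2)\<^sup>n\<close>, the numerator also by \<open>s\<close>, when passing from \<open>1 / (q u)\<close> to \<open>u\<close>.
\<close>
lemma rational_functional_equation:
  fixes Z :: "complex \<Rightarrow> complex" and K :: "complex mat" and a b q s :: complex and p :: "complex poly"
  assumes K: "K \<in> carrier_mat n n" and q: "q = (b - 1) * (a - 1)" "q \<noteq> 0"
    and Z: "\<And>u. u \<noteq> 1 \<Longrightarrow> 1 + (a - 1) * u \<noteq> 0 \<Longrightarrow>
      (1 - u) ^ (n + m) * (1 + (a - 1) * u) ^ n * Z u = (1 - u) ^ N * (1 + (a - 1) * u) ^ m *
        det (((1 + (a - 1) * u) * (1 + (b - 1) * u)) \<cdot>\<^sub>m 1\<^sub>m n - u \<cdot>\<^sub>m K)"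
    and p: "rational_eq (\<lambda>u. poly p u ^ n) (\<lambda>u. s * (q * u\<^sup>2) ^ n * poly p (1 / (q * u)) ^ n)"
  defines "L \<equiv> \<lambda>u. poly p u ^ n * (1 - u) powi (int N - int (n + m)) *
      (1 + (a - 1) * u) powi (int m - int n) * inverse (Z u)"
  shows "rational_eq L (\<lambda>u. s * L (1 / (q * u)))"
proof -
  define D where "D = (\<lambda>u. det (((1 + (a - 1) * u) * (1 + (b - 1) * u)) \<cdot>\<^sub>m 1\<^sub>m n - u \<cdot>\<^sub>m K))"
  have L_eq: "L u = poly p u ^ n * inverse (D u)" if "u \<noteq> 1" "1 + (a - 1) * u \<noteq> 0" for u
  proof -
    define x y where "x = 1 - u" and "y = 1 + (a - 1) * u"
    have nz: "x \<noteq> 0" "y \<noteq> 0"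
      using that by (simp_all add: x_def y_def)
    have "x ^ (n + m) * y ^ n * Z u = x ^ N * y ^ m * D u"
      using Z[OF that] by (simp add: D_def x_def y_def)
    then have "Z u = x ^ N * y ^ m * D u / (x ^ (n + m) * y ^ n)"
      using nz by (simp add: nonzero_eq_divide_eq mult.commute)
    moreover have "L u = poly p u ^ n * (x ^ N / x ^ (n + m)) * (y ^ m / y ^ n) * inverse (Z u)"
      unfolding L_def x_def[symmetric] y_def[symmetric] using nz
      by (simp add: power_int_diff del: of_nat_add)
    ultimately show ?thesis
      using nz by (simp add: field_simps)
  qed
  \<comment> \<open>Outside \<open>E\<close> neither \<open>u\<close> nor \<open>1 / (q u)\<close> is a zero of \<open>1 - u\<close> or of \<open>1 + (a - 1) u\<close>.\<close>
  define E where "E = {0, 1, - 1 / (a - 1), 1 / q, - (a - 1) / q}"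
  have "finite E"
    by (simp add: E_def)
  then have "\<forall>\<^sub>F u in cofinite. u \<notin> E"
    by (simp add: eventually_cofinite)
  moreover have "\<forall>\<^sub>F u in cofinite. poly p u ^ n = s * (q * u\<^sup>2) ^ n * poly p (1 / (q * u)) ^ n"
    using p by (simp add: rational_eq_def)
  ultimately show ?thesis
    unfolding rational_eq_def
  proof eventually_elim
    case (elim u)
    define w where "w = 1 / (q * u)"
    have u: "u \<noteq> 0" "u \<noteq> 1"
      using elim(1) by (simp_all add: E_def)
    have \<alpha>u: "1 + (a - 1) * u \<noteq> 0"
    proof
      assume *: "1 + (a - 1) * u = 0"
      then have "a - 1 \<noteq> 0"
        by auto
      moreover have "u * (a - 1) = - 1"
        using * by (simp add: eq_neg_iff_add_eq_0 ac_simps)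
      ultimately have "u = - 1 / (a - 1)"
        by (simp only: nonzero_eq_divide_eq simp_thms)
      then show False
        using elim(1) by (simp add: E_def)
    qed
    have w: "w \<noteq> 1" "1 + (a - 1) * w \<noteq> 0"
      using elim(1) u(1) q(2) by (auto simp: E_def w_def field_simps eq_neg_iff_add_eq_0)
    have "D u = (q * u\<^sup>2) ^ n * D w"
      unfolding D_def w_def using K q u(1) by (rule det_functional_equation)
    then have "L u = s * (q * u\<^sup>2) ^ n * poly p w ^ n * inverse ((q * u\<^sup>2) ^ n * D w)"
      using L_eq[OF u(2) \<alpha>u] elim(2) by (simp add: w_def)
    also have "\<dots> = s * (poly p w ^ n * inverse (D w))"
      using q(2) u(1) by simp
    also have "\<dots> = s * L w"
      using L_eq[OF w] by simp
    finally show ?case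
      by (simp add: w_def)
  qed
qed

theorem corollary19:
  fixes H :: "('v, 'e) hypergraph" and d r n\<^sub>1 n\<^sub>2 :: nat and q :: int and p :: "complex poly"
  assumes "is_hypergraph H" and "finite_hypergraph H" and "connected_hypergraph H"
    and "regular_hypergraph d r H" and "d \<ge> r"
    and "n\<^sub>1 = card (hypervertices H)" and "n\<^sub>2 = card (hyperedges H)"
    and "q = (int d - 1) * (int r - 1)" and "q \<noteq> 0"
  shows
    "(\<forall>s\<in>{1, - 1}.
        rational_eq (\<lambda>u. poly p u ^ n\<^sub>1)
          (\<lambda>u. s * (of_int q * u\<^sup>2) ^ n\<^sub>1 * poly p (1 / (of_int q * u)) ^ n\<^sub>1) \<longrightarrow>
        rational_eq (\<lambda>u. Lambda H r p u) (\<lambda>u. s * Lambda H r p (1 / (of_int q * u)))) \<and>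
     (\<forall>s\<in>{1, - 1}.
        rational_eq (\<lambda>u. poly p u ^ n\<^sub>2)
          (\<lambda>u. s * (of_int q * u\<^sup>2) ^ n\<^sub>2 * poly p (1 / (of_int q * u)) ^ n\<^sub>2) \<longrightarrow>
        rational_eq (\<lambda>u. Lambda_tilde H d p u)
          (\<lambda>u. s * Lambda_tilde H d p (1 / (of_int q * u))))"
proof -
  define N where "N = card (flags H)"
  let ?q = "of_int q :: complex"
  have q: "?q = (of_nat d - 1) * (of_nat r - 1)" "?q = (of_nat r - 1) * (of_nat d - 1)" "?q \<noteq> 0"
    using assms(8,9) by (simp_all add: mult.commute)
  have \<chi>: "- euler_char H = int N - int (n\<^sub>1 + n\<^sub>2)" "- euler_char H = int N - int (n\<^sub>2 + n\<^sub>1)"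
    using euler_char_eq[OF assms(2)] by (simp_all add: N_def assms(6,7))
  have \<Lambda>: "Lambda H r p = (\<lambda>u. poly p u ^ n\<^sub>1 * (1 - u) powi (int N - int (n\<^sub>1 + n\<^sub>2)) *
      (1 + (of_nat r - 1) * u) powi (int n\<^sub>2 - int n\<^sub>1) * inverse (poly (zeta_inv_poly H) u))"
    unfolding Lambda_def hypergraph_zeta_def Let_def assms(6,7)[symmetric] \<chi>(1) ..
  have \<Lambda>': "Lambda_tilde H d p = (\<lambda>u. poly p u ^ n\<^sub>2 * (1 - u) powi (int N - int (n\<^sub>2 + n\<^sub>1)) *
      (1 + (of_nat d - 1) * u) powi (int n\<^sub>1 - int n\<^sub>2) * inverse (poly (zeta_inv_poly H) u))"
    unfolding Lambda_tilde_def hypergraph_zeta_def Let_def assms(6,7)[symmetric] \<chi>(2) ..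
  note zeta = zeta_inv_poly_determinant[OF assms(1,2,4), folded assms(6,7) N_def]
  obtain K\<^sub>1 where K\<^sub>1: "K\<^sub>1 \<in> carrier_mat n\<^sub>1 n\<^sub>1" and
    zeta\<^sub>1: "\<And>u. u \<noteq> 1 \<Longrightarrow> 1 + (of_nat r - 1) * u \<noteq> 0 \<Longrightarrow>
      (1 - u) ^ (n\<^sub>1 + n\<^sub>2) * (1 + (of_nat r - 1) * u) ^ n\<^sub>1 * poly (zeta_inv_poly H) u =
      (1 - u) ^ N * (1 + (of_nat r - 1) * u) ^ n\<^sub>2 *
        det (((1 + (of_nat r - 1) * u) * (1 + (of_nat d - 1) * u)) \<cdot>\<^sub>m 1\<^sub>m n\<^sub>1 - u \<cdot>\<^sub>m K\<^sub>1)"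
    using zeta(1) by blast
  obtain K\<^sub>2 where K\<^sub>2: "K\<^sub>2 \<in> carrier_mat n\<^sub>2 n\<^sub>2" and
    zeta\<^sub>2: "\<And>u. u \<noteq> 1 \<Longrightarrow> 1 + (of_nat d - 1) * u \<noteq> 0 \<Longrightarrow>
      (1 - u) ^ (n\<^sub>2 + n\<^sub>1) * (1 + (of_nat d - 1) * u) ^ n\<^sub>2 * poly (zeta_inv_poly H) u =
      (1 - u) ^ N * (1 + (of_nat d - 1) * u) ^ n\<^sub>1 *
        det (((1 + (of_nat d - 1) * u) * (1 + (of_nat r - 1) * u)) \<cdot>\<^sub>m 1\<^sub>m n\<^sub>2 - u \<cdot>\<^sub>m K\<^sub>2)"
    using zeta(2) by blast
  show ?thesis
    unfolding \<Lambda> \<Lambda>'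
    using rational_functional_equation[OF K\<^sub>1 q(1,3) zeta\<^sub>1]
      rational_functional_equation[OF K\<^sub>2 q(2,3) zeta\<^sub>2] by blast
qed

end
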